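(* Let $\mathcal H$ be an infinite-dimensional Hilbert space, let $k\ge 1$, and let $F\colon\mathcal D_+^k\to B(\mathcal H)$ be a convex regular map. Then its perspective $\mathcal P_F\colon\mathcal D_+^{k+1}\to B(\mathcal H)$, defined by \[ \mathcal P_F(A_1,\dots,A_k,B)=B^{1/2}F(B^{-1/2}A_1B^{-1/2},\dots,B^{-1/2}A_kB^{-1/2})B^{1/2}, \] is convex.
   Context: $B(\mathcal K)$ denotes the bounded linear operators on a Hilbert space $\mathcal K$; $S\le T$ means that $T-S$ is positive semi-definite. For a nonzero closed subspace $\mathcal K\subseteq\mathcal H$ let $\mathcal D_+^k(\mathcal K)$ be the set of $k$-tuples $(A_1,\dots,A_k)$ of positive invertible operators in $B(\mathcal K)$, and write $\mathcal D_+^k=\mathcal D_+^k(\mathcal H)$. A map $F$ on $\mathcal D_+^k$ is convex if $F(\lambda A+(1-\lambda)B)\le\lambda F(A)+(1-\lambda)F(B)$ for all $k$-tuples $A,B\in\mathcal D_+^k$ and $\lambda\in[0,1]$ (joint convexity); similarly for maps on $\mathcal D_+^{k+1}$. Regular mappings. A map $F\colon\mathcal D_+^k\to B(\mathcal H)$ is called regular if there are maps $F_{\mathcal K}\colon\mathcal D_+^k(\mathcal K)\to B(\mathcal K)$, one for each nonzero closed subspace $\mathcal K\subseteq\mathcal H$, with $F_{\mathcal H}=F$, such that: (1) (unitary invariance) $F_{\mathcal L}(ux_1u^*,\dots,ux_ku^* )=uF_{\mathcal K}(x_1,\dots,x_k)u^*$ for every unitary $u\colon\mathcal K\to\mathcal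 L$ between nonzero closed subspaces $\mathcal K,\mathcal L$ of $\mathcal H$ and every $(x_1,\dots,x_k)\in\mathcal D_+^k(\mathcal K)$; (2) (block diagonal rule) $F_{\mathcal K\oplus\mathcal L}(x_1\oplus y_1,\dots,x_k\oplus y_k)=F_{\mathcal K}(x_1,\dots,x_k)\oplus F_{\mathcal L}(y_1,\dots,y_k)$ for mutually orthogonal nonzero closed subspaces $\mathcal K,\mathcal L$ of $\mathcal H$, $(x_i)\in\mathcal D_+^k(\mathcal K)$ and $(y_i)\in\mathcal D_+^k(\mathcal L)$. In particular, $F$ extends consistently to tuples of operators on $\mathcal H\oplus\mathcal H\cong\mathcal H$ with $F(x\oplus y)=F(x)\oplus F(y)$. *)

theory Defs
  imports "HOL-Analysis.Analysis"
begin

text \<open>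
  Complex inner product spaces, linear in the second argument. Norm and topology come from
  \<open>real_inner\<close>; positive definiteness is inherited through the real part, and
  \<open>cinner x x\<close> is real by conjugate symmetry.
\<close>

class complex_inner = real_inner +
  fixes scaleC :: "complex \<Rightarrow> 'a \<Rightarrow> 'a" (infixr "*\<^sub>C" 75)
    and cinner :: "'a \<Rightarrow> 'a \<Rightarrow> complex"
  assumes scaleC_add_right: "c *\<^sub>C (x + y) = c *\<^sub>C x + c *\<^sub>C y"
    and scaleC_add_left: "(c + d) *\<^sub>C x = c *\<^sub>C x + d *\<^sub>C x"
    and scaleC_scaleC: "c *\<^sub>C d *\<^sub>C x = (c * d) *\<^sub>C x"
    and scaleC_one: "1 *\<^sub>C x = x"
    and scaleR_scaleC: "r *\<^sub>R x = complex_of_real r *\<^sub>C x"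
    and cinner_commute: "cinner x y = cnj (cinner y x)"
    and cinner_add_right: "cinner x (y + z) = cinner x y + cinner x z"
    and cinner_scaleC_right: "cinner x (c *\<^sub>C y) = c * cinner x y"
    and Re_cinner: "Re (cinner x y) = inner x y"

class chilbert_space = complex_inner + complete_space

global_interpretation complex_vector: vector_space "scaleC :: complex \<Rightarrow> 'a \<Rightarrow> 'a::complex_inner"
  by unfold_locales (rule scaleC_add_right scaleC_add_left scaleC_scaleC scaleC_one)+

type_synonym 'a operator = "'a \<Rightarrow>\<^sub>L 'a"

definition closed_csubspaces :: "'a::complex_inner set set" where
  "closed_csubspaces = {K. complex_vector.subspace K \<and> closed K \<and> K \<noteq> {0}}"
  \<comment> \<open>the zero subspace is excluded\<close>

definition ortho :: "'a::complex_inner set \<Rightarrow> 'a set" where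
  "ortho K = {x. \<forall>y\<in>K. cinner y x = 0}"

definition clinear_op :: "'a::complex_inner operator \<Rightarrow> bool" where
  "clinear_op T \<longleftrightarrow> (\<forall>c x. blinfun_apply T (c *\<^sub>C x) = c *\<^sub>C blinfun_apply T x)"

text \<open>
  An operator between closed subspaces \<open>K\<close> and \<open>L\<close> is represented by its extension to the whole
  space that vanishes on the orthogonal complement of \<open>K\<close>. Thus \<open>bounded_ops K\<close>, which is
  \<open>B(K)\<close>, consists of the operators \<open>T\<close> with \<open>T = P T P\<close> for the orthogonal projection \<open>P\<close>
  onto \<open>K\<close>, and \<open>bounded_ops UNIV\<close> is \<open>B(H)\<close>. In this representation the orthogonal
  direct sum of operators is their sum, and composition and adjoints are those of \<open>B(H)\<close>.
\<close>

definition bounded_ops :: "'a::complex_inner set \<Rightarrow> 'a operator set" where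
  "bounded_ops K = {T. clinear_op T \<and> range (blinfun_apply T) \<subseteq> K \<and>
     (\<forall>x\<in>ortho K. blinfun_apply T x = 0)}"

definition positive_op :: "'a::complex_inner operator \<Rightarrow> bool" where
  "positive_op T \<longleftrightarrow> (\<forall>x. cinner x (blinfun_apply T x) \<in> \<real> \<and> 0 \<le> Re (cinner x (blinfun_apply T x)))"

definition op_le :: "'a::complex_inner operator \<Rightarrow> 'a operator \<Rightarrow> bool" where
  "op_le S T \<longleftrightarrow> positive_op (T - S)"

text \<open>Invertibility is meant in \<open>B(K)\<close>, whose unit is the projection onto \<open>K\<close>.\<close>

definition invertible_in :: "'a::complex_inner set \<Rightarrow> 'a operator \<Rightarrow> bool" where
  "invertible_in K T \<longleftrightarrow> (\<exists>S\<in>bounded_ops K. \<forall>x\<in>K.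
     blinfun_apply S (blinfun_apply T x) = x \<and> blinfun_apply T (blinfun_apply S x) = x)"

text \<open>A \<open>k\<close>-tuple of operators is a list of length \<open>k\<close>.\<close>

definition pos_tuples :: "nat \<Rightarrow> 'a::complex_inner set \<Rightarrow> 'a operator list set" where
  "pos_tuples k K = {As. length As = k \<and>
     (\<forall>A\<in>set As. A \<in> bounded_ops K \<and> positive_op A \<and> invertible_in K A)}"

definition convex_op_map :: "nat \<Rightarrow> ('a::complex_inner operator list \<Rightarrow> 'a operator) \<Rightarrow> bool" where
  "convex_op_map k F \<longleftrightarrow> (\<forall>As\<in>pos_tuples k UNIV. \<forall>Bs\<in>pos_tuples k UNIV. \<forall>l\<in>{0..1::real}.
     op_le (F (map2 (\<lambda>A B. l *\<^sub>R A + (1 - l) *\<^sub>R B) As Bs)) (l *\<^sub>R F As + (1 - l) *\<^sub>R F Bs))"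

definition op_adj :: "'a::complex_inner operator \<Rightarrow> 'a operator" where
  "op_adj T = (THE S. \<forall>x y. cinner (blinfun_apply T x) y = cinner x (blinfun_apply S y))"

text \<open>
  A unitary from \<open>K\<close> onto \<open>L\<close>, extended by zero, is a partial isometry; its adjoint in \<open>B(H)\<close> is
  the extension by zero of the adjoint from \<open>L\<close> to \<open>K\<close>.
\<close>

definition unitary_between :: "'a::complex_inner set \<Rightarrow> 'a set \<Rightarrow> 'a operator \<Rightarrow> bool" where
  "unitary_between K L u \<longleftrightarrow> clinear_op u \<and> (\<forall>x\<in>ortho K. blinfun_apply u x = 0) \<and>
     blinfun_apply u ` K = L \<and>
     (\<forall>x\<in>K. \<forall>y\<in>K. cinner (blinfun_apply u x) (blinfun_apply u y) = cinner x y)"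

definition regular_map :: "nat \<Rightarrow> ('a::complex_inner operator list \<Rightarrow> 'a operator) \<Rightarrow> bool" where
  "regular_map k F \<longleftrightarrow> (\<exists>G :: 'a set \<Rightarrow> 'a operator list \<Rightarrow> 'a operator.
     (\<forall>K\<in>closed_csubspaces. G K \<in> pos_tuples k K \<rightarrow> bounded_ops K) \<and>
     (\<forall>xs\<in>pos_tuples k UNIV. G UNIV xs = F xs) \<and>
     (\<forall>K\<in>closed_csubspaces. \<forall>L\<in>closed_csubspaces. \<forall>u. unitary_between K L u \<longrightarrow>
        (\<forall>xs\<in>pos_tuples k K.
           G L (map (\<lambda>x. u o\<^sub>L x o\<^sub>L op_adj u) xs) = u o\<^sub>L G K xs o\<^sub>L op_adj u)) \<and>
     (\<forall>K\<in>closed_csubspaces. \<forall>L\<in>closed_csubspaces. (\<forall>x\<in>K. \<forall>y\<in>L. cinner x y = 0) \<longrightarrow>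
        (\<forall>xs\<in>pos_tuples k K. \<forall>ys\<in>pos_tuples k L.
           G {x + y |x y. x \<in> K \<and> y \<in> L} (map2 (+) xs ys) = G K xs + G L ys)))"

definition op_inv :: "'a::complex_inner operator \<Rightarrow> 'a operator" where
  "op_inv T = (THE S. S \<in> bounded_ops UNIV \<and> S o\<^sub>L T = id_blinfun \<and> T o\<^sub>L S = id_blinfun)"

definition op_sqrt :: "'a::complex_inner operator \<Rightarrow> 'a operator" where
  "op_sqrt T = (THE S. S \<in> bounded_ops UNIV \<and> positive_op S \<and> S o\<^sub>L S = T)"

text \<open>The argument is the list \<open>[A\<^sub>1, \<dots>, A\<^sub>k, B]\<close>.\<close>

definition perspective ::
    "('a::complex_inner operator list \<Rightarrow> 'a operator) \<Rightarrow> 'a operator list \<Rightarrow> 'a operator" where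
  "perspective F As = (let R = op_sqrt (last As); Q = op_inv R in
     R o\<^sub>L F (map (\<lambda>A. Q o\<^sub>L A o\<^sub>L Q) (butlast As)) o\<^sub>L R)"

end

theory Submission imports Defs begin

text \<open>
  Perspectives inherit convexity from Jensen's operator inequality
  \<open>F(C\<^sup>* X C + D\<^sup>* Y D) \<le> C\<^sup>* F(X) C + D\<^sup>* F(Y) D\<close>, valid for a convex regular map \<open>F\<close> whenever
  \<open>C\<^sup>* C + D\<^sup>* D = 1\<close> and \<open>C\<close> is invertible (\<open>regular_map_jensen\<close>). Given \<open>M = l B + (1 - l) B'\<close> with
  \<open>0 < l < 1\<close>, the operators \<open>C = (l B)\<^sup>1\<^sup>/\<^sup>2 M\<^sup>-\<^sup>1\<^sup>/\<^sup>2\<close> and \<open>D = ((1 - l) B')\<^sup>1\<^sup>/\<^sup>2 M\<^sup>-\<^sup>1\<^sup>/\<^sup>2\<close>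
  satisfy \<open>C\<^sup>* C + D\<^sup>* D = 1\<close>. Taking the normalized tuples
  \<open>B\<^sup>-\<^sup>1\<^sup>/\<^sup>2 A\<^sub>i B\<^sup>-\<^sup>1\<^sup>/\<^sup>2\<close> and \<open>B'\<^sup>-\<^sup>1\<^sup>/\<^sup>2 A'\<^sub>i B'\<^sup>-\<^sup>1\<^sup>/\<^sup>2\<close> for \<open>X\<close> and \<open>Y\<close> and multiplying Jensen's
  inequality by \<open>M\<^sup>1\<^sup>/\<^sup>2\<close> on both sides turns it into convexity of the perspective
  (\<open>perspective_convex_interior\<close>).

  Jensen's inequality lives on \<open>H \<oplus> H\<close>, which is brought back to \<open>H\<close> by two isometries \<open>S\<close>, \<open>T\<close> with
  \<open>S S\<^sup>* + T T\<^sup>* = 1\<close> (a \<open>cuntz_pair\<close>). They exist because an infinite orthonormal basis is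
  equipotent to two disjoint copies of itself (\<open>cuntz_pair_exists\<close>); this is where infinite dimension
  enters. Regularity says that \<open>F\<close> respects the block decomposition of any such pair
  (\<open>regular_map_block\<close>). If \<open>V\<close>, \<open>W\<close> is a pair, then \<open>J = V V\<^sup>* - W W\<^sup>*\<close> is unitary, and the mean of \<open>Z\<close>
  and \<open>J Z J\<close> is block diagonal with blocks \<open>V\<^sup>* Z V\<close> and \<open>W\<^sup>* Z W\<close>; convexity at this midpoint,
  read off in the first block, gives \<open>F(V\<^sup>* Z V) \<le> V\<^sup>* F(Z) V\<close> (\<open>regular_map_compression\<close>). Applied to
  the isometry \<open>V = S C + T D\<close>, which \<open>cuntz_pair_completion\<close> completes to a pair, and to the
  block diagonal \<open>Z = S X S\<^sup>* + T Y T\<^sup>*\<close>, this is Jensen's inequality.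

  Inverses and square roots of strictly positive operators are obtained as fixed points of
  contractions, and the orthonormal basis from the projection theorem and Zorn's lemma.
\<close>

section \<open>Complex inner products\<close>

instance chilbert_space \<subseteq> banach ..

lemma cinner_add_left: "cinner (x + y) z = cinner x z + cinner y z"
  by (metis cinner_add_right cinner_commute complex_cnj_add)

lemma cinner_scaleC_left: "cinner (c *\<^sub>C x) y = cnj c * cinner x y"
  by (metis cinner_commute cinner_scaleC_right complex_cnj_mult)

lemma cinner_scaleR_right: "cinner x (r *\<^sub>R y) = of_real r * cinner x y"
  by (simp add: scaleR_scaleC cinner_scaleC_right)

lemma cinner_scaleR_left: "cinner (r *\<^sub>R x) y = of_real r * cinner x y"
  by (simp add: scaleR_scaleC cinner_scaleC_left)

lemma cinner_minus_right: "cinner x (- y) = - cinner x y"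
  using cinner_scaleR_right[of x "-1" y] by simp

lemma cinner_minus_left: "cinner (- x) y = - cinner x y"
  using cinner_scaleR_left[of "-1" x y] by simp

lemma cinner_diff_right: "cinner x (y - z) = cinner x y - cinner x z"
  using cinner_add_right[of x y "-z"] by (simp add: cinner_minus_right)

lemma cinner_diff_left: "cinner (x - y) z = cinner x z - cinner y z"
  using cinner_add_left[of x "-y" z] by (simp add: cinner_minus_left)

lemma cinner_zero_right [simp]: "cinner x 0 = 0"
  using cinner_diff_right[of x 0 0] by simp

lemma cinner_zero_left [simp]: "cinner 0 x = 0"
  using cinner_diff_left[of 0 0 x] by simp

lemmas cinner_algebra =
  cinner_add_left cinner_add_right cinner_scaleC_left cinner_scaleC_right
  cinner_scaleR_left cinner_scaleR_right cinner_minus_left cinner_minus_right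
  cinner_diff_left cinner_diff_right

lemma cinner_self: "cinner x x = of_real ((norm x)\<^sup>2)"
proof (rule complex_eqI)
  have "Im (cinner x x) = - Im (cinner x x)"
    using arg_cong[OF cinner_commute[of x x], of Im] by simp
  then show "Im (cinner x x) = Im (of_real ((norm x)\<^sup>2))" by simp
qed (simp add: Re_cinner power2_norm_eq_inner)

lemma cinner_eqI:
  assumes "\<And>x. cinner x y = cinner x z"
  shows "y = z"
proof -
  have "cinner (y - z) (y - z) = 0"
    using assms[of "y - z"] by (simp add: cinner_diff_right)
  then show ?thesis by (simp add: cinner_self)
qed

lemma cinner_conv_inner: "cinner x y = Complex (inner x y) (inner (\<i> *\<^sub>C x) y)"
proof (rule complex_eqI)
  have "Im (cinner x y) = Re (cinner (\<i> *\<^sub>C x) y)"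
    by (simp add: cinner_scaleC_left)
  then show "Im (cinner x y) = Im (Complex (inner x y) (inner (\<i> *\<^sub>C x) y))"
    by (simp add: Re_cinner)
qed (simp add: Re_cinner)

lemma scaleC_zero_right [simp]: "c *\<^sub>C (0::'a::complex_inner) = 0"
  by (simp add: complex_vector.scale_zero_right)

lemma norm_scaleC: "norm (c *\<^sub>C x) = cmod c * norm x"
proof -
  have "complex_of_real ((norm (c *\<^sub>C x))\<^sup>2) = (c * cnj c) * cinner x x"
    by (simp only: cinner_self[symmetric] cinner_scaleC_left cinner_scaleC_right ac_simps)
  also have "\<dots> = of_real ((cmod c * norm x)\<^sup>2)"
    by (simp only: cinner_self complex_norm_square[symmetric] power_mult_distrib of_real_mult)
  finally have "(norm (c *\<^sub>C x))\<^sup>2 = (cmod c * norm x)\<^sup>2"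
    using of_real_eq_iff by blast
  then show ?thesis by simp
qed

lemma bounded_linear_scaleC: "bounded_linear (\<lambda>x::'a::complex_inner. c *\<^sub>C x)"
proof (rule bounded_linear_intro[where K = "cmod c"])
  show "c *\<^sub>C (r *\<^sub>R x) = r *\<^sub>R (c *\<^sub>C x)" for r and x :: 'a
    by (simp add: scaleR_scaleC scaleC_scaleC mult.commute)
qed (simp_all add: scaleC_add_right norm_scaleC mult.commute)

lemma continuous_on_scaleC [continuous_intros]:
  "continuous_on S f \<Longrightarrow> continuous_on S (\<lambda>x. c *\<^sub>C (f x :: 'a::complex_inner))"
  by (rule bounded_linear.continuous_on[OF bounded_linear_scaleC])

lemma continuous_on_cinner [continuous_intros]:
  fixes f g :: "'b::topological_space \<Rightarrow> 'a::complex_inner"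
  assumes "continuous_on S f" "continuous_on S g"
  shows "continuous_on S (\<lambda>x. cinner (f x) (g x))"
  unfolding cinner_conv_inner Complex_eq
  by (intro continuous_intros assms)

section \<open>Adjoints and strictly positive operators\<close>

text \<open>
  A relation and not a function: adjoints are given below by explicit formulas, and an operator
  that occurs in such a pair is automatically complex linear.
\<close>

definition adjoint_pair :: "'a::complex_inner operator \<Rightarrow> 'a operator \<Rightarrow> bool" where
  "adjoint_pair T S \<longleftrightarrow>
     (\<forall>x y. cinner (blinfun_apply T x) y = cinner x (blinfun_apply S y))"

lemma adjoint_pairD: "adjoint_pair T S \<Longrightarrow> cinner (blinfun_apply T x) y = cinner x (blinfun_apply S y)"
  by (simp add: adjoint_pair_def)

lemma adjoint_pair_sym: "adjoint_pair T S \<Longrightarrow> adjoint_pair S T"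
  unfolding adjoint_pair_def by (metis cinner_commute)

lemma adjoint_pair_clinear: 
  assumes "adjoint_pair T S" shows "clinear_op T"
  unfolding clinear_op_def
proof (intro allI)
  fix c x
  show "blinfun_apply T (c *\<^sub>C x) = c *\<^sub>C blinfun_apply T x"
    by (rule cinner_eqI)
      (simp add: cinner_scaleC_right adjoint_pairD[OF adjoint_pair_sym[OF assms], symmetric])
qed

lemma adjoint_pair_unique:
  assumes "adjoint_pair T S" "adjoint_pair T S'" shows "S = S'"
proof (intro blinfun_eqI cinner_eqI)
  show "cinner x (blinfun_apply S y) = cinner x (blinfun_apply S' y)" for x y
    using adjoint_pairD[OF assms(1), of x y] adjoint_pairD[OF assms(2), of x y] by simp
qed

lemma op_adj_eqI: "adjoint_pair T S \<Longrightarrow> op_adj T = S"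
  unfolding op_adj_def adjoint_pair_def[symmetric]
  by (rule the_equality) (auto intro: adjoint_pair_unique)

lemma adjoint_pair_id: "adjoint_pair id_blinfun id_blinfun"
  by (simp add: adjoint_pair_def)

lemma adjoint_pair_compose:
  "adjoint_pair S S' \<Longrightarrow> adjoint_pair T T' \<Longrightarrow> adjoint_pair (S o\<^sub>L T) (T' o\<^sub>L S')"
  by (simp add: adjoint_pair_def)

lemma adjoint_pair_add:
  "adjoint_pair S S' \<Longrightarrow> adjoint_pair T T' \<Longrightarrow> adjoint_pair (S + T) (S' + T')"
  by (simp add: adjoint_pair_def blinfun.add_left cinner_algebra)

lemma adjoint_pair_diff:
  "adjoint_pair S S' \<Longrightarrow> adjoint_pair T T' \<Longrightarrow> adjoint_pair (S - T) (S' - T')"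
  by (simp add: adjoint_pair_def blinfun.diff_left cinner_algebra)

lemma adjoint_pair_scaleR:
  "adjoint_pair T T' \<Longrightarrow> adjoint_pair (r *\<^sub>R T) (r *\<^sub>R T')"
  by (simp add: adjoint_pair_def blinfun.scaleR_left cinner_algebra)

lemmas adjoint_pair_intros = adjoint_pair_id adjoint_pair_compose adjoint_pair_add
  adjoint_pair_diff adjoint_pair_scaleR

text \<open>
  Polarization: reality of the quadratic form at \<open>x + y\<close> makes the imaginary parts of the form
  antisymmetric, and the same at \<open>x + \<i> y\<close> makes the real parts symmetric.
\<close>

lemma selfadjoint_iff_real_form:
  assumes "clinear_op T"
  shows "adjoint_pair T T \<longleftrightarrow> (\<forall>x. cinner x (blinfun_apply T x) \<in> \<real>)"
proof
  assume T: "adjoint_pair T T"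
  show "\<forall>x. cinner x (blinfun_apply T x) \<in> \<real>"
  proof
    fix x
    have "cnj (cinner x (blinfun_apply T x)) = cinner x (blinfun_apply T x)"
      using T by (metis adjoint_pairD cinner_commute)
    then show "cinner x (blinfun_apply T x) \<in> \<real>" by (simp add: Reals_cnj_iff)
  qed
next
  assume R: "\<forall>x. cinner x (blinfun_apply T x) \<in> \<real>"
  have lin: "blinfun_apply T (c *\<^sub>C x) = c *\<^sub>C blinfun_apply T x" for c x
    using assms by (simp add: clinear_op_def)
  let ?b = "\<lambda>x y. cinner x (blinfun_apply T y)"
  have real: "Im (?b x x) = 0" for x
    using R complex_is_Real_iff by blast
  have I: "Im (?b x y) + Im (?b y x) = 0" for x y
    using real[of "x + y"] real[of x] real[of y] by (simp add: blinfun.add_right cinner_algebra)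
  have R: "Re (?b x y) - Re (?b y x) = 0" for x y
    using I[of x "\<i> *\<^sub>C y"] by (simp add: lin cinner_algebra)
  have sym: "?b x y = cnj (?b y x)" for x y
    using I[of x y] R[of x y] by (intro complex_eqI) auto
  show "adjoint_pair T T"
    unfolding adjoint_pair_def
  proof (intro allI)
    fix x y
    show "cinner (blinfun_apply T x) y = cinner x (blinfun_apply T y)"
      using sym[of x y] by (simp add: cinner_commute[of _ y])
  qed
qed

lemma clinear_op_compose: "clinear_op S \<Longrightarrow> clinear_op T \<Longrightarrow> clinear_op (S o\<^sub>L T)"
  by (simp add: clinear_op_def)

lemma ortho_UNIV: "ortho UNIV = {0}"
  by (auto simp: ortho_def intro: cinner_eqI)

lemma bounded_ops_UNIV: "T \<in> bounded_ops UNIV \<longleftrightarrow> clinear_op T"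
  by (auto simp: bounded_ops_def ortho_UNIV)

text \<open>
  Coercivity. It coincides with positivity together with invertibility (\<open>pos_tuples_UNIV\<close>), and in
  this form it visibly passes to sums and congruences.
\<close>

definition pos_def :: "'a::complex_inner operator \<Rightarrow> bool" where
  "pos_def T \<longleftrightarrow> adjoint_pair T T \<and> (\<exists>e>0. \<forall>x. e * (norm x)\<^sup>2 \<le> inner x (blinfun_apply T x))"

lemma pos_def_selfadjoint: "pos_def T \<Longrightarrow> adjoint_pair T T"
  by (simp add: pos_def_def)

lemma pos_defE:
  assumes "pos_def T"
  obtains e where "0 < e" "\<And>x. e * (norm x)\<^sup>2 \<le> inner x (blinfun_apply T x)"
  using assms unfolding pos_def_def by blast

lemma pos_def_add: 
  assumes "pos_def S" "pos_def T" shows "pos_def (S + T)"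
proof -
  obtain d where d: "0 < d" "\<And>x. d * (norm x)\<^sup>2 \<le> inner x (blinfun_apply S x)" 
    using pos_defE[OF assms(1)] by blast
  obtain e where e: "0 < e" "\<And>x. e * (norm x)\<^sup>2 \<le> inner x (blinfun_apply T x)" 
    using pos_defE[OF assms(2)] by blast
  have "(d + e) * (norm x)\<^sup>2 \<le> inner x (blinfun_apply (S + T) x)" for x
    using d(2)[of x] e(2)[of x] by (simp add: blinfun.add_left inner_add_right algebra_simps)
  moreover have "0 < d + e" using d(1) e(1) by simp
  ultimately show ?thesis using assms unfolding pos_def_def by (blast intro: adjoint_pair_add)
qed

lemma pos_def_scaleR:
  assumes "pos_def T" "0 < r" shows "pos_def (r *\<^sub>R T)"
proof -
  obtain e where e: "0 < e" "\<And>x. e * (norm x)\<^sup>2 \<le> inner x (blinfun_apply T x)" 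
    using pos_defE[OF assms(1)] by blast
  have "(r * e) * (norm x)\<^sup>2 \<le> inner x (blinfun_apply (r *\<^sub>R T) x)" for x
    using mult_left_mono[OF e(2)[of x], of r] assms(2) by (simp add: blinfun.scaleR_left algebra_simps)
  moreover have "0 < r * e" using e(1) assms(2) by simp
  ultimately show ?thesis using assms unfolding pos_def_def by (blast intro: adjoint_pair_scaleR)
qed

lemma pos_def_add_nonneg: 
  assumes "pos_def S" "adjoint_pair T T" "\<And>x. 0 \<le> inner x (blinfun_apply T x)" 
  shows "pos_def (S + T)"
proof -
  obtain d where d: "0 < d" "\<And>x. d * (norm x)\<^sup>2 \<le> inner x (blinfun_apply S x)" 
    using pos_defE[OF assms(1)] by blast
  have "d * (norm x)\<^sup>2 \<le> inner x (blinfun_apply (S + T) x)" for x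
    using d(2)[of x] assms(3)[of x] by (simp add: blinfun.add_left inner_add_right)
  then show ?thesis using d(1) assms unfolding pos_def_def by (blast intro: adjoint_pair_add)
qed

lemma pos_def_id: "pos_def id_blinfun"
  unfolding pos_def_def by (auto intro!: adjoint_pair_id exI[of _ 1] simp: power2_norm_eq_inner)

lemma adjoint_pair_inner: 
  "adjoint_pair T S \<Longrightarrow> inner (blinfun_apply T x) y = inner x (blinfun_apply S y)"
  by (metis adjoint_pairD Re_cinner)

lemma norm_le_left_inverse:
  assumes "\<And>x. blinfun_apply L (blinfun_apply M x) = x"
  obtains c where "0 < c" "\<And>x. c * (norm x)\<^sup>2 \<le> (norm (blinfun_apply M x))\<^sup>2"
proof
  \<comment> \<open>The summand 1 keeps the denominator positive even when \<open>L = 0\<close>.\<close>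
  let ?n = "norm L + 1"
  have n: "0 < ?n" using norm_ge_zero[of L] by linarith
  show "0 < 1 / ?n\<^sup>2" using n by simp
  fix x
  have "norm x \<le> norm L * norm (blinfun_apply M x)"
    using norm_blinfun[of L "blinfun_apply M x"] assms by simp
  also have "\<dots> \<le> ?n * norm (blinfun_apply M x)" by (simp add: mult_right_mono)
  finally have "(norm x)\<^sup>2 \<le> (?n * norm (blinfun_apply M x))\<^sup>2"
    by (rule power_mono) simp
  then have "(norm x)\<^sup>2 / ?n\<^sup>2 \<le> (norm (blinfun_apply M x))\<^sup>2"
    using n by (subst pos_divide_le_eq) (simp_all only: power_mult_distrib mult.commute zero_less_power)
  then show "1 / ?n\<^sup>2 * (norm x)\<^sup>2 \<le> (norm (blinfun_apply M x))\<^sup>2" by simp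
qed

lemma pos_def_congruence:
  assumes T: "pos_def T" and M: "adjoint_pair M N" and L: "\<And>x. blinfun_apply L (blinfun_apply M x) = x"
  shows "pos_def (N o\<^sub>L T o\<^sub>L M)"
proof -
  obtain e where e: "0 < e" "\<And>x. e * (norm x)\<^sup>2 \<le> inner x (blinfun_apply T x)" 
    using pos_defE[OF T] by blast
  obtain c where c: "0 < c" "\<And>x. c * (norm x)\<^sup>2 \<le> (norm (blinfun_apply M x))\<^sup>2"
    using norm_le_left_inverse[OF L] by blast
  have "(e * c) * (norm x)\<^sup>2 \<le> inner x (blinfun_apply (N o\<^sub>L T o\<^sub>L M) x)" for x
  proof -
    have "(e * c) * (norm x)\<^sup>2 \<le> e * (norm (blinfun_apply M x))\<^sup>2"
      using mult_left_mono[OF c(2), of e x] e(1) by (simp add: algebra_simps)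
    also have "\<dots> \<le> inner (blinfun_apply M x) (blinfun_apply T (blinfun_apply M x))"
      by (rule e(2))
    finally show ?thesis using adjoint_pair_inner[OF M] by simp
  qed
  moreover have "adjoint_pair (N o\<^sub>L T o\<^sub>L M) (N o\<^sub>L T o\<^sub>L M)"
    using adjoint_pair_compose[OF adjoint_pair_compose[OF adjoint_pair_sym[OF M] pos_def_selfadjoint[OF T]] M]
    by (auto simp: adjoint_pair_def)
  moreover have "0 < e * c" using e(1) c(1) by simp
  ultimately show ?thesis unfolding pos_def_def by blast
qed

lemma pos_def_imp_positive_op: 
  assumes "pos_def T" shows "positive_op T"
  unfolding positive_op_def
proof (intro allI conjI)
  obtain e where e: "0 < e" "\<And>x. e * (norm x)\<^sup>2 \<le> inner x (blinfun_apply T x)" 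
    using pos_defE[OF assms] by blast
  fix x
  show "cinner x (blinfun_apply T x) \<in> \<real>"
    using selfadjoint_iff_real_form[OF adjoint_pair_clinear] pos_def_selfadjoint[OF assms] by blast
  have "0 \<le> e * (norm x)\<^sup>2" using e(1) by simp
  then show "0 \<le> Re (cinner x (blinfun_apply T x))"
    unfolding Re_cinner using e(2)[of x] by linarith
qed

lemma positive_op_selfadjoint: "positive_op T \<Longrightarrow> clinear_op T \<Longrightarrow> adjoint_pair T T"
  using selfadjoint_iff_real_form unfolding positive_op_def by blast

text \<open>
  Positivity tested at \<open>x - T x / M\<close> with \<open>M \<ge> \<parallel>T\<parallel>\<close> gives \<open>\<parallel>T x\<parallel>\<^sup>2 \<le> M \<langle>x, T x\<rangle>\<close>, and the left
  inverse bounds \<open>\<parallel>T x\<parallel>\<close> from below.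
\<close>

lemma pos_def_if_positive_invertible:
  assumes pos: "positive_op T" and lin: "clinear_op T"
    and inv: "\<And>x. blinfun_apply S (blinfun_apply T x) = x"
  shows "pos_def T"
proof -
  have sa: "adjoint_pair T T" by (rule positive_op_selfadjoint[OF pos lin])
  define M where "M = norm T + 1"
  have M: "0 < M" "norm T \<le> M" using norm_ge_zero[of T] by (auto simp: M_def simp del: norm_ge_zero)
  obtain c where c: "0 < c" "\<And>x. c * (norm x)\<^sup>2 \<le> (norm (blinfun_apply T x))\<^sup>2"
    using norm_le_left_inverse[OF inv] by blast
  have key: "(norm (blinfun_apply T x))\<^sup>2 / M \<le> inner x (blinfun_apply T x)" for x
  proof -
    let ?y = "blinfun_apply T x" and ?s = "1 / M"
    have "0 \<le> inner (x - ?s *\<^sub>R ?y) (blinfun_apply T (x - ?s *\<^sub>R ?y))"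
      using pos by (simp add: positive_op_def Re_cinner)
    also have "\<dots> = inner x ?y - 2 * ?s * (norm ?y)\<^sup>2 + ?s\<^sup>2 * inner ?y (blinfun_apply T ?y)"
      using adjoint_pair_inner[OF sa, of x ?y]
      by (simp add: blinfun.diff_right blinfun.scaleR_right inner_diff_left inner_diff_right
          power2_norm_eq_inner inner_commute[of x ?y] algebra_simps power2_eq_square[of "1 / M"])
    also have "inner ?y (blinfun_apply T ?y) \<le> norm ?y * norm (blinfun_apply T ?y)"
      by (rule norm_cauchy_schwarz)
    also have "\<dots> \<le> norm ?y * (M * norm ?y)"
      by (intro mult_left_mono order_trans[OF norm_blinfun] mult_right_mono M) auto
    finally have "0 \<le> inner x ?y - 2 * ?s * (norm ?y)\<^sup>2 + ?s\<^sup>2 * (norm ?y * (M * norm ?y))"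
      by (simp add: mult_left_mono)
    also have "\<dots> = inner x ?y - (norm ?y)\<^sup>2 / M"
      using M by (simp add: power2_eq_square field_simps)
    finally show ?thesis by simp
  qed
  have "(c / M) * (norm x)\<^sup>2 \<le> inner x (blinfun_apply T x)" for x
    using key[of x] divide_right_mono[OF c(2)[of x], of M] M by simp
  moreover have "0 < c / M" using c M by simp
  ultimately show ?thesis using sa unfolding pos_def_def by blast
qed

section \<open>Inverses\<close>

text \<open>
  If \<open>e \<parallel>x\<parallel>\<^sup>2 \<le> \<langle>x, T x\<rangle>\<close> and \<open>\<parallel>T\<parallel> \<le> M\<close>, then \<open>\<parallel>x - t T x\<parallel>\<^sup>2 \<le> (1 - 2 t e + t\<^sup>2 M\<^sup>2) \<parallel>x\<parallel>\<^sup>2\<close>; the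
  right-hand side is smallest for \<open>t = e / M\<^sup>2\<close>.
\<close>

lemma norm_id_minus_scaleR_less_1:
  fixes T :: "'a::complex_inner operator"
  assumes "pos_def T"
  obtains t a where "0 < t" "0 \<le> a" "a < 1" "norm (id_blinfun - t *\<^sub>R T) \<le> a"
proof -
  obtain e where e: "0 < e" "\<And>x. e * (norm x)\<^sup>2 \<le> inner x (blinfun_apply T x)" 
    using pos_defE[OF assms] by blast
  define M where "M = norm T + e"
  have M: "0 < M" "norm T \<le> M" "e \<le> M" using norm_ge_zero[of T] e(1) by (auto simp: M_def simp del: norm_ge_zero)
  define t where "t = e / M\<^sup>2"
  define a where "a = sqrt (1 - e\<^sup>2 / M\<^sup>2)"
  have t: "0 < t" using e(1) M by (simp add: t_def)
  have "e\<^sup>2 \<le> M\<^sup>2" using e(1) M by (intro power_mono) auto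
  then have a: "0 \<le> a" "a < 1" "a\<^sup>2 = 1 - e\<^sup>2 / M\<^sup>2" using e(1) M by (auto simp: a_def)
  have "norm (blinfun_apply (id_blinfun - t *\<^sub>R T) x) \<le> a * norm x" for x
  proof (rule power2_le_imp_le)
    let ?y = "blinfun_apply T x"
    have "norm ?y \<le> M * norm x"
      by (intro order_trans[OF norm_blinfun] mult_right_mono M) auto
    then have "(norm ?y)\<^sup>2 \<le> (M * norm x)\<^sup>2" by (rule power_mono) auto
    then have 1: "t\<^sup>2 * (norm ?y)\<^sup>2 \<le> t\<^sup>2 * (M * norm x)\<^sup>2" by (rule mult_left_mono) auto
    have 2: "2 * t * (e * (norm x)\<^sup>2) \<le> 2 * t * inner x ?y"
      using e(2)[of x] t by (intro mult_left_mono) auto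
    have "(norm (blinfun_apply (id_blinfun - t *\<^sub>R T) x))\<^sup>2
        = (norm x)\<^sup>2 - 2 * t * inner x ?y + t\<^sup>2 * (norm ?y)\<^sup>2"
      by (simp add: blinfun.diff_left blinfun.scaleR_left power2_norm_eq_inner inner_diff_left inner_diff_right
          inner_commute[of ?y x] algebra_simps power2_eq_square[of t])
    also have "\<dots> \<le> (norm x)\<^sup>2 - 2 * t * (e * (norm x)\<^sup>2) + t\<^sup>2 * (M * norm x)\<^sup>2"
      using 1 2 by linarith
    also have "\<dots> = (1 - e\<^sup>2 / M\<^sup>2) * (norm x)\<^sup>2"
      using M(1) by (simp add: t_def field_simps power2_eq_square)
    also have "\<dots> = (a * norm x)\<^sup>2"
      by (simp only: power_mult_distrib a(3))
    finally show "(norm (blinfun_apply (id_blinfun - t *\<^sub>R T) x))\<^sup>2 \<le> (a * norm x)\<^sup>2" .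
  qed (use a in simp)
  then have "norm (id_blinfun - t *\<^sub>R T) \<le> a" using a(1) by (intro norm_blinfun_bound)
  then show thesis using that t a by blast
qed

text \<open>
  The inverse of \<open>1 - Y\<close> is the fixed point of a contraction of the Banach space of operators.
\<close>

lemma neumann_right_inverse:
  fixes Y :: "'a::banach \<Rightarrow>\<^sub>L 'a"
  assumes "norm Y < 1"
  obtains R where "R = id_blinfun + (Y o\<^sub>L R)"
proof -
  have "\<exists>!R. id_blinfun + (Y o\<^sub>L R) = R"
  proof (rule banach_fix_type)
    show "0 \<le> norm Y" by simp
    show "\<forall>R S. dist (id_blinfun + (Y o\<^sub>L R)) (id_blinfun + (Y o\<^sub>L S)) \<le> norm Y * dist R S"
      by (metis add_diff_cancel_left bounded_bilinear.diff_right bounded_bilinear_blinfun_compose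
          dist_norm norm_blinfun_compose)
  qed (rule assms)
  then show thesis using that by metis
qed

lemma neumann_left_inverse:
  fixes Y :: "'a::banach \<Rightarrow>\<^sub>L 'a"
  assumes "norm Y < 1"
  obtains R where "R = id_blinfun + (R o\<^sub>L Y)"
proof -
  have "\<exists>!R. id_blinfun + (R o\<^sub>L Y) = R"
  proof (rule banach_fix_type)
    show "0 \<le> norm Y" by simp
    show "\<forall>R S. dist (id_blinfun + (R o\<^sub>L Y)) (id_blinfun + (S o\<^sub>L Y)) \<le> norm Y * dist R S"
      by (metis add_diff_cancel_left bounded_bilinear.diff_left bounded_bilinear_blinfun_compose
          dist_norm norm_blinfun_compose mult.commute)
  qed (rule assms)
  then show thesis using that by metis
qed

lemma pos_def_inverse:
  fixes T :: "'a::chilbert_space operator"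
  assumes "pos_def T"
  obtains S where "pos_def S" "\<And>x. blinfun_apply S (blinfun_apply T x) = x"
    "\<And>x. blinfun_apply T (blinfun_apply S x) = x"
proof -
  obtain t a where ta: "0 < t" "0 \<le> a" "a < 1" "norm (id_blinfun - t *\<^sub>R T) \<le> a"
    using norm_id_minus_scaleR_less_1[OF assms] .
  let ?Y = "id_blinfun - t *\<^sub>R T"
  have n: "norm ?Y < 1" using ta by linarith
  obtain R where R: "R = id_blinfun + (?Y o\<^sub>L R)" using neumann_right_inverse[OF n] .
  obtain L where L: "L = id_blinfun + (L o\<^sub>L ?Y)" using neumann_left_inverse[OF n] .
  have "blinfun_apply R x = x + (blinfun_apply R x - t *\<^sub>R blinfun_apply T (blinfun_apply R x))" for x
    using arg_cong[OF R, of "\<lambda>U. blinfun_apply U x"]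
    by (simp add: blinfun.add_left blinfun.diff_left blinfun.scaleR_left)
  then have r: "t *\<^sub>R blinfun_apply T (blinfun_apply R x) = x" for x
    by (metis add_diff_cancel_left' add_diff_eq diff_add_cancel diff_diff_eq2)
  have "blinfun_apply L x = x + (blinfun_apply L x - t *\<^sub>R blinfun_apply L (blinfun_apply T x))" for x
    using arg_cong[OF L, of "\<lambda>U. blinfun_apply U x"]
    by (simp add: blinfun.add_left blinfun.diff_left blinfun.scaleR_left blinfun.diff_right blinfun.scaleR_right)
  then have l: "t *\<^sub>R blinfun_apply L (blinfun_apply T x) = x" for x
    by (metis add_diff_cancel_left' add_diff_eq diff_add_cancel diff_diff_eq2)
  define S where "S = t *\<^sub>R R"
  have TS: "blinfun_apply T (blinfun_apply S x) = x" for x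
    using r[of x] by (simp add: S_def blinfun.scaleR_left blinfun.scaleR_right)
  have "blinfun_apply S x = t *\<^sub>R blinfun_apply L x" for x
    using l[of "blinfun_apply S x"] by (simp add: TS)
  then have ST: "blinfun_apply S (blinfun_apply T x) = x" for x
    using l by simp
  have "adjoint_pair S S"
    unfolding adjoint_pair_def using adjoint_pairD[OF pos_def_selfadjoint[OF assms]] TS by metis
  moreover have "S = S o\<^sub>L T o\<^sub>L S" by (intro blinfun_eqI) (simp add: TS)
  ultimately have "pos_def S" using pos_def_congruence[OF assms _ TS] by metis
  then show thesis using that ST TS by blast
qed

lemma pos_tuples_UNIV:
  fixes As :: "'a::chilbert_space operator list"
  shows "As \<in> pos_tuples k UNIV \<longleftrightarrow> length As = k \<and> (\<forall>A\<in>set As. pos_def A)"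
proof -
  have "A \<in> bounded_ops UNIV \<and> positive_op A \<and> invertible_in UNIV A \<longleftrightarrow> pos_def A"
    for A :: "'a operator"
  proof
    assume "A \<in> bounded_ops UNIV \<and> positive_op A \<and> invertible_in UNIV A"
    then show "pos_def A"
      unfolding bounded_ops_UNIV invertible_in_def using pos_def_if_positive_invertible[of A] by blast
  next
    assume A: "pos_def A"
    obtain S where "pos_def S" "\<And>x. blinfun_apply S (blinfun_apply A x) = x"
      "\<And>x. blinfun_apply A (blinfun_apply S x) = x" using pos_def_inverse[OF A] by blast
    then show "A \<in> bounded_ops UNIV \<and> positive_op A \<and> invertible_in UNIV A"
      unfolding bounded_ops_UNIV invertible_in_def
      using A by (metis adjoint_pair_clinear pos_def_selfadjoint pos_def_imp_positive_op bounded_ops_UNIV)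
  qed
  then show ?thesis unfolding pos_tuples_def by blast
qed

section \<open>Square roots\<close>

lemma norm_square_diff_le:
  fixes Y Z :: "'a::real_normed_vector \<Rightarrow>\<^sub>L 'a"
  assumes "norm Y \<le> a" "norm Z \<le> a"
  shows "norm ((Y o\<^sub>L Y) - (Z o\<^sub>L Z)) \<le> 2 * a * norm (Y - Z)"
proof -
  have "(Y o\<^sub>L Y) - (Z o\<^sub>L Z) = (Y o\<^sub>L (Y - Z)) + ((Y - Z) o\<^sub>L Z)"
    by (intro blinfun_eqI) (simp add: blinfun.diff_left blinfun.diff_right blinfun.add_left)
  also have "norm \<dots> \<le> norm Y * norm (Y - Z) + norm (Y - Z) * norm Z"
    by (intro norm_triangle_le add_mono norm_blinfun_compose)
  also have "\<dots> \<le> a * norm (Y - Z) + norm (Y - Z) * a"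
    by (intro add_mono mult_left_mono mult_right_mono assms) auto
  finally show ?thesis by simp
qed

text \<open>
  Writing \<open>1 - A = (1 - Y)\<^sup>2\<close> amounts to \<open>Y = (A + Y\<^sup>2) / 2\<close>, and for \<open>\<parallel>A\<parallel> \<le> a < 1\<close> the right-hand
  side is an \<open>a\<close>-contraction of the ball of radius \<open>a\<close>. It also preserves self-adjointness and the
  property of commuting with everything that commutes with \<open>A\<close>; the latter is what makes the
  positive square root unique.
\<close>

lemma sqrt_fixed_point:
  fixes A :: "'a::chilbert_space operator"
  assumes A: "norm A \<le> a" "a < 1" "adjoint_pair A A"
  obtains Y where "2 *\<^sub>R Y = A + (Y o\<^sub>L Y)" "norm Y \<le> a" "adjoint_pair Y Y"
    "\<forall>R. R o\<^sub>L A = A o\<^sub>L R \<longrightarrow> R o\<^sub>L Y = Y o\<^sub>L R"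
proof -
  define f where "f Y = (1/2) *\<^sub>R (A + (Y o\<^sub>L Y))" for Y
  define D where "D = {Y. norm Y \<le> a \<and> adjoint_pair Y Y \<and>
    (\<forall>R. R o\<^sub>L A = A o\<^sub>L R \<longrightarrow> R o\<^sub>L Y = Y o\<^sub>L R)}"
  have a: "0 \<le> a" using A(1) norm_ge_zero order_trans by blast
  have "\<exists>!Y. Y \<in> D \<and> f Y = Y"
  proof (rule Banach_fix)
    have "closed {Y. norm Y \<le> a}"
      by (intro closed_Collect_le continuous_intros)
    moreover have "closed {Y :: 'a operator. adjoint_pair Y Y}"
      unfolding adjoint_pair_def by (intro closed_Collect_all closed_Collect_eq continuous_intros)
    moreover have "closed {Y. \<forall>R. R o\<^sub>L A = A o\<^sub>L R \<longrightarrow> R o\<^sub>L Y = Y o\<^sub>L R}"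
      by (intro closed_Collect_all closed_Collect_imp closed_Collect_eq open_Collect_const
        bounded_bilinear.continuous_on[OF bounded_bilinear_blinfun_compose] continuous_intros)
    ultimately have "closed D"
      unfolding D_def by (intro closed_Collect_conj)
    then show "complete D" by (simp add: complete_eq_closed)
    have "0 \<in> D" using a by (auto simp: D_def adjoint_pair_def intro!: blinfun_eqI)
    then show "D \<noteq> {}" by blast
    show "0 \<le> a" "a < 1" using a A(2) by auto
    show "f ` D \<subseteq> D"
    proof safe
      fix Y assume "Y \<in> D"
      then have Y: "norm Y \<le> a" "adjoint_pair Y Y" "\<And>R. R o\<^sub>L A = A o\<^sub>L R \<Longrightarrow> R o\<^sub>L Y = Y o\<^sub>L R"
        by (auto simp: D_def)
      have "norm (Y o\<^sub>L Y) \<le> a * 1"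
        using order_trans[OF norm_blinfun_compose mult_mono[OF Y(1) order_trans[OF Y(1) less_imp_le[OF A(2)]]]] a
        by simp
      then have "norm (A + (Y o\<^sub>L Y)) \<le> a + a" using A(1) by (intro norm_triangle_le) simp
      then have 1: "norm (f Y) \<le> a" by (simp add: f_def)
      have 2: "adjoint_pair (f Y) (f Y)"
        unfolding f_def by (intro adjoint_pair_intros A Y)
      have 3: "R o\<^sub>L f Y = f Y o\<^sub>L R" if R: "R o\<^sub>L A = A o\<^sub>L R" for R
      proof (rule blinfun_eqI)
        fix x
        have "blinfun_apply R (blinfun_apply A x) = blinfun_apply A (blinfun_apply R x)" for x
          using arg_cong[OF R, of "\<lambda>U. blinfun_apply U x"] by simp
        moreover have "blinfun_apply R (blinfun_apply Y x) = blinfun_apply Y (blinfun_apply R x)" for x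
          using arg_cong[OF Y(3)[OF R], of "\<lambda>U. blinfun_apply U x"] by simp
        ultimately show "blinfun_apply (R o\<^sub>L f Y) x = blinfun_apply (f Y o\<^sub>L R) x"
          by (simp add: f_def blinfun.scaleR_left blinfun.add_left blinfun.scaleR_right blinfun.add_right)
      qed
      show "f Y \<in> D" using 1 2 3 by (simp add: D_def)
    qed
    show "dist (f Y) (f Z) \<le> a * dist Y Z" if "Y \<in> D" "Z \<in> D" for Y Z
    proof -
      have "f Y - f Z = (1/2) *\<^sub>R ((Y o\<^sub>L Y) - (Z o\<^sub>L Z))"
        by (simp add: f_def scaleR_diff_right scaleR_add_right)
      then have "norm (f Y - f Z) = 1/2 * norm ((Y o\<^sub>L Y) - (Z o\<^sub>L Z))" by simp
      moreover have "norm Y \<le> a" "norm Z \<le> a" using that by (auto simp: D_def)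
      ultimately show ?thesis
        using norm_square_diff_le[of Y a Z] unfolding dist_norm by linarith
    qed
  qed
  then obtain Y where Y: "Y \<in> D" "f Y = Y" by blast
  have "2 *\<^sub>R Y = A + (Y o\<^sub>L Y)"
    using arg_cong[OF Y(2), of "\<lambda>U. 2 *\<^sub>R U"] by (simp add: f_def)
  moreover have "norm Y \<le> a" "adjoint_pair Y Y" "\<forall>R. R o\<^sub>L A = A o\<^sub>L R \<longrightarrow> R o\<^sub>L Y = Y o\<^sub>L R"
    using Y(1) unfolding D_def by blast+
  ultimately show thesis using that by blast
qed

lemma pos_def_id_minus:
  fixes Y :: "'a::complex_inner operator"
  assumes "norm Y < 1" "adjoint_pair Y Y"
  shows "pos_def (id_blinfun - Y)"
proof -
  have "(1 - norm Y) * (norm x)\<^sup>2 \<le> inner x (blinfun_apply (id_blinfun - Y) x)" for x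
  proof -
    have "inner x (blinfun_apply Y x) \<le> norm x * (norm Y * norm x)"
      by (intro order_trans[OF norm_cauchy_schwarz] mult_left_mono norm_blinfun) simp
    then show ?thesis
      by (simp add: blinfun.diff_left inner_diff_right power2_norm_eq_inner[symmetric])
        (simp add: algebra_simps power2_eq_square)
  qed
  then show ?thesis using assms unfolding pos_def_def
    by (intro conjI exI[of _ "1 - norm Y"]) (auto intro: adjoint_pair_intros)
qed

lemma pos_def_sqrt_exists:
  fixes T :: "'a::chilbert_space operator"
  assumes "pos_def T"
  obtains S where "pos_def S" "S o\<^sub>L S = T" "\<And>R. R o\<^sub>L T = T o\<^sub>L R \<Longrightarrow> R o\<^sub>L S = S o\<^sub>L R"
proof -
  obtain t a where ta: "0 < t" "0 \<le> a" "a < 1" "norm (id_blinfun - t *\<^sub>R T) \<le> a"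
    using norm_id_minus_scaleR_less_1[OF assms] .
  define A where "A = id_blinfun - t *\<^sub>R T"
  have A: "norm A \<le> a" "adjoint_pair A A"
    unfolding A_def by (intro ta(4) adjoint_pair_intros pos_def_selfadjoint assms)+
  obtain Y where Y: "2 *\<^sub>R Y = A + (Y o\<^sub>L Y)" "norm Y \<le> a" "adjoint_pair Y Y"
    "\<forall>R. R o\<^sub>L A = A o\<^sub>L R \<longrightarrow> R o\<^sub>L Y = Y o\<^sub>L R"
    using sqrt_fixed_point[OF A(1) ta(3) A(2)] by blast
  define S where "S = (1 / sqrt t) *\<^sub>R (id_blinfun - Y)"
  have "pos_def S"
    unfolding S_def using Y(2,3) ta(1,3) by (intro pos_def_scaleR pos_def_id_minus) auto
  moreover have "S o\<^sub>L S = T"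
  proof (rule blinfun_eqI)
    fix x
    have e: "blinfun_apply Y (blinfun_apply Y x) = 2 *\<^sub>R blinfun_apply Y x - (x - t *\<^sub>R blinfun_apply T x)"
      using arg_cong[OF Y(1), of "\<lambda>U. blinfun_apply U x"]
      by (simp add: A_def blinfun.add_left blinfun.diff_left blinfun.scaleR_left)
    have "blinfun_apply (S o\<^sub>L S) x = (1 / sqrt t * (1 / sqrt t)) *\<^sub>R
        (x - 2 *\<^sub>R blinfun_apply Y x + blinfun_apply Y (blinfun_apply Y x))"
      by (simp add: S_def blinfun.diff_left blinfun.scaleR_left blinfun.diff_right blinfun.scaleR_right
          algebra_simps scaleR_2)
    also have "\<dots> = blinfun_apply T x"
      unfolding e using ta(1) by (simp add: algebra_simps)
    finally show "blinfun_apply (S o\<^sub>L S) x = blinfun_apply T x" .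
  qed
  moreover have "R o\<^sub>L S = S o\<^sub>L R" if R: "R o\<^sub>L T = T o\<^sub>L R" for R
  proof -
    have "blinfun_apply R (blinfun_apply T x) = blinfun_apply T (blinfun_apply R x)" for x
      using arg_cong[OF R, of "\<lambda>U. blinfun_apply U x"] by simp
    then have "R o\<^sub>L A = A o\<^sub>L R"
      by (intro blinfun_eqI)
        (simp add: A_def blinfun.diff_left blinfun.scaleR_left blinfun.diff_right blinfun.scaleR_right)
    then have "R o\<^sub>L Y = Y o\<^sub>L R" using Y(4) by blast
    then have "blinfun_apply R (blinfun_apply Y x) = blinfun_apply Y (blinfun_apply R x)" for x
      by (metis blinfun_apply_blinfun_compose)
    then show ?thesis
      by (intro blinfun_eqI)
        (simp add: S_def blinfun.diff_left blinfun.scaleR_left blinfun.diff_right blinfun.scaleR_right)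
  qed
  ultimately show thesis using that by blast
qed

text \<open>
  Uniqueness: any positive \<open>R\<close> with \<open>R\<^sup>2 = T\<close> commutes with \<open>T\<close>, hence with the square root \<open>S\<close>
  constructed above, so that \<open>(S + R) (S - R) = S\<^sup>2 - R\<^sup>2 = 0\<close>.
\<close>

lemma op_sqrt_pos_def:
  fixes T :: "'a::chilbert_space operator"
  assumes "pos_def T"
  shows "pos_def (op_sqrt T)" "op_sqrt T o\<^sub>L op_sqrt T = T"
proof -
  obtain S where S: "pos_def S" "S o\<^sub>L S = T" "\<And>R. R o\<^sub>L T = T o\<^sub>L R \<Longrightarrow> R o\<^sub>L S = S o\<^sub>L R"
    using pos_def_sqrt_exists[OF assms] by blast
  obtain e where e: "0 < e" "\<And>x. e * (norm x)\<^sup>2 \<le> inner x (blinfun_apply S x)"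
    using pos_defE[OF S(1)] by blast
  have "op_sqrt T = S"
    unfolding op_sqrt_def
  proof (rule the_equality)
    show "S \<in> bounded_ops UNIV \<and> positive_op S \<and> S o\<^sub>L S = T"
      using S pos_def_imp_positive_op pos_def_selfadjoint adjoint_pair_clinear bounded_ops_UNIV by blast
    fix R assume R: "R \<in> bounded_ops UNIV \<and> positive_op R \<and> R o\<^sub>L R = T"
    have "R o\<^sub>L T = T o\<^sub>L R" using R by (intro blinfun_eqI) (auto simp: blinfun_compose.rep_eq)
    then have "R o\<^sub>L S = S o\<^sub>L R" by (rule S(3))
    then have comm: "blinfun_apply R (blinfun_apply S x) = blinfun_apply S (blinfun_apply R x)" for x
      by (metis blinfun_apply_blinfun_compose)
    have sq: "blinfun_apply R (blinfun_apply R x) = blinfun_apply S (blinfun_apply S x)" for x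
      using R S(2) by (metis blinfun_apply_blinfun_compose)
    show "R = S"
    proof (rule blinfun_eqI)
      fix x
      \<comment> \<open>Since \<open>S + R\<close> is coercive, it suffices that it kills the difference \<open>y\<close>.\<close>
      define y where "y = blinfun_apply S x - blinfun_apply R x"
      have "blinfun_apply S y + blinfun_apply R y = 0"
        by (simp add: y_def blinfun.diff_right comm sq)
      then have "inner y (blinfun_apply S y) + inner y (blinfun_apply R y) = 0"
        by (simp add: inner_add_right[symmetric])
      moreover have "0 \<le> inner y (blinfun_apply R y)"
        using R by (simp add: positive_op_def Re_cinner)
      ultimately have "e * (norm y)\<^sup>2 \<le> 0" using e(2)[of y] by linarith
      then have "y = 0" using e(1) by (simp add: mult_le_0_iff)
      then show "blinfun_apply R x = blinfun_apply S x" by (simp add: y_def)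
    qed
  qed
  then show "pos_def (op_sqrt T)" "op_sqrt T o\<^sub>L op_sqrt T = T" using S(1,2) by simp_all
qed

lemma op_inv_eqI:
  assumes "clinear_op S" "\<And>x. blinfun_apply S (blinfun_apply T x) = x"
    "\<And>x. blinfun_apply T (blinfun_apply S x) = x"
  shows "op_inv T = S"
  unfolding op_inv_def
proof (rule the_equality)
  show "S \<in> bounded_ops UNIV \<and> S o\<^sub>L T = id_blinfun \<and> T o\<^sub>L S = id_blinfun"
    using assms by (auto simp: bounded_ops_UNIV intro!: blinfun_eqI)
  fix R assume "R \<in> bounded_ops UNIV \<and> R o\<^sub>L T = id_blinfun \<and> T o\<^sub>L R = id_blinfun"
  then have "blinfun_apply R (blinfun_apply T x) = x" for x
    by (metis blinfun_apply_blinfun_compose blinfun_apply_id_blinfun id_apply)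
  from this[of "blinfun_apply S _"] show "R = S"
    by (intro blinfun_eqI) (simp add: assms)
qed

lemma op_inv_pos_def:
  fixes T :: "'a::chilbert_space operator"
  assumes "pos_def T"
  shows "pos_def (op_inv T)" "blinfun_apply (op_inv T) (blinfun_apply T x) = x"
    "blinfun_apply T (blinfun_apply (op_inv T) x) = x"
proof -
  obtain S where S: "pos_def S" "\<And>x. blinfun_apply S (blinfun_apply T x) = x"
    "\<And>x. blinfun_apply T (blinfun_apply S x) = x" using pos_def_inverse[OF assms] by blast
  then have "op_inv T = S"
    by (intro op_inv_eqI adjoint_pair_clinear[OF pos_def_selfadjoint]) auto
  then show "pos_def (op_inv T)" "blinfun_apply (op_inv T) (blinfun_apply T x) = x"
    "blinfun_apply T (blinfun_apply (op_inv T) x) = x" using S by auto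
qed

section \<open>Orthonormal bases\<close>

lemma csubspace_scaleR:
  "complex_vector.subspace M \<Longrightarrow> x \<in> M \<Longrightarrow> r *\<^sub>R x \<in> M"
  by (simp add: scaleR_scaleC complex_vector.subspace_scale)

text \<open>
  The projection theorem: the parallelogram law makes a distance-minimizing sequence in \<open>M\<close> Cauchy,
  and the difference of \<open>x\<close> and its limit is orthogonal to \<open>M\<close>.
\<close>

lemma orthogonal_vector_exists:
  fixes M :: "'a::chilbert_space set"
  assumes M: "complex_vector.subspace M" "closed M" and "M \<noteq> UNIV"
  obtains z where "z \<noteq> 0" "\<And>y. y \<in> M \<Longrightarrow> cinner y z = 0"
proof -
  obtain x where x: "x \<notin> M" using assms(3) by blast
  define D where "D = (\<lambda>y. (norm (x - y))\<^sup>2) ` M"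
  define d where "d = Inf D"
  have "0 \<in> M" using M(1) by (rule complex_vector.subspace_0)
  then have D: "D \<noteq> {}" "bdd_below D"
    unfolding D_def by (auto intro!: bdd_belowI2[of _ 0])
  have lower: "d \<le> (norm (x - y))\<^sup>2" if "y \<in> M" for y
    unfolding d_def using D(2) that by (intro cInf_lower) (auto simp: D_def)
  have "\<exists>y\<in>M. (norm (x - y))\<^sup>2 < d + inverse (real (Suc n))" for n
  proof -
    have "Inf D < d + inverse (real (Suc n))" by (simp add: d_def)
    then show ?thesis using cInf_less_iff[OF D] unfolding D_def by blast
  qed
  then obtain m where m: "\<And>n. m n \<in> M" "\<And>n. (norm (x - m n))\<^sup>2 < d + inverse (real (Suc n))"
    by metis
  have close: "(norm (m i - m j))\<^sup>2 \<le> 4 * inverse (real (Suc N))" if "N \<le> i" "N \<le> j" for i j N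
  proof -
    let ?h = "(1/2) *\<^sub>R (m i + m j)"
    have "?h \<in> M"
      by (intro csubspace_scaleR[OF M(1)] complex_vector.subspace_add[OF M(1)] m)
    then have "d \<le> (norm (x - ?h))\<^sup>2" by (rule lower)
    moreover have "(norm (m i - m j))\<^sup>2
        = 2 * (norm (x - m i))\<^sup>2 + 2 * (norm (x - m j))\<^sup>2 - 4 * (norm (x - ?h))\<^sup>2"
      by (simp add: power2_norm_eq_inner inner_diff_left inner_diff_right inner_add_left
          inner_add_right inner_commute algebra_simps)
    moreover have "inverse (real (Suc i)) \<le> inverse (real (Suc N))"
      "inverse (real (Suc j)) \<le> inverse (real (Suc N))"
      using that by (auto intro!: le_imp_inverse_le)
    ultimately show ?thesis using m(2)[of i] m(2)[of j] by linarith
  qed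
  have "Cauchy m"
  proof (rule metric_CauchyI)
    fix e :: real assume e: "0 < e"
    then obtain N where N: "inverse (real (Suc N)) < e\<^sup>2 / 4"
      using reals_Archimedean[of "e\<^sup>2 / 4"] by auto
    have "dist (m i) (m j) < e" if "N \<le> i" "N \<le> j" for i j
    proof -
      have "(norm (m i - m j))\<^sup>2 < e\<^sup>2" using close[OF that] N by linarith
      then show ?thesis using e unfolding dist_norm by (simp add: power2_less_imp_less)
    qed
    then show "\<exists>N. \<forall>i\<ge>N. \<forall>j\<ge>N. dist (m i) (m j) < e" by blast
  qed
  then obtain l where l: "m \<longlonglongrightarrow> l" using Cauchy_convergent convergent_def by blast
  have "l \<in> M" using closed_sequentially[OF M(2) _ l] m(1) by blast
  define z where "z = x - l"
  have "z \<noteq> 0" using x \<open>l \<in> M\<close> by (auto simp: z_def)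
  have "(\<lambda>n. (norm (x - m n))\<^sup>2) \<longlonglongrightarrow> (norm (x - l))\<^sup>2"
    by (intro tendsto_intros l)
  moreover have "(\<lambda>n. d + inverse (real (Suc n))) \<longlonglongrightarrow> d + 0"
    by (intro tendsto_intros LIMSEQ_inverse_real_of_nat)
  ultimately have z: "(norm z)\<^sup>2 \<le> d"
    unfolding z_def using m(2) by (intro LIMSEQ_le[where Y = "\<lambda>n. d + inverse (real (Suc n))"]) (auto intro: less_imp_le)
  have orth: "inner y z = 0" if y: "y \<in> M" for y
  proof (cases "y = 0")
    case False
    \<comment> \<open>The minimizer of \<open>\<parallel>z - t y\<parallel>\<^sup>2\<close> over real \<open>t\<close>.\<close>
    define t where "t = inner y z / (norm y)\<^sup>2"
    have "l + t *\<^sub>R y \<in> M"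
      using \<open>l \<in> M\<close> y by (intro complex_vector.subspace_add[OF M(1)] csubspace_scaleR[OF M(1)])
    then have "(norm z)\<^sup>2 \<le> (norm (z - t *\<^sub>R y))\<^sup>2"
      using order_trans[OF z lower] by (simp add: z_def diff_diff_eq)
    also have "\<dots> = (norm z)\<^sup>2 - 2 * t * inner y z + t\<^sup>2 * (norm y)\<^sup>2"
      by (simp add: power2_norm_eq_inner inner_diff_left inner_diff_right inner_commute[of z y]
          power2_eq_square[of t] algebra_simps)
    also have "\<dots> = (norm z)\<^sup>2 - (inner y z)\<^sup>2 / (norm y)\<^sup>2"
      using False by (simp add: t_def field_simps power2_eq_square)
    finally have "(inner y z)\<^sup>2 / (norm y)\<^sup>2 \<le> 0" by simp
    then show ?thesis using False by (simp add: divide_le_0_iff)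
  qed simp
  have "cinner y z = 0" if "y \<in> M" for y
    unfolding cinner_conv_inner using that orth complex_vector.subspace_scale[OF M(1)]
    by (simp add: zero_complex.ctr)
  then show thesis using that \<open>z \<noteq> 0\<close> by blast
qed

lemma csubspace_closure:
  fixes M :: "'a::complex_inner set"
  assumes M: "complex_vector.subspace M"
  shows "complex_vector.subspace (closure M)"
  unfolding complex_vector.subspace_def
proof (intro conjI ballI allI)
  show "0 \<in> closure M" using complex_vector.subspace_0[OF M] closure_subset by blast
  fix x assume "x \<in> closure M"
  then obtain a where a: "\<And>n. a n \<in> M" "a \<longlonglongrightarrow> x" by (auto simp: closure_sequential)
  show "x + y \<in> closure M" if yM: "y \<in> closure M" for y
  proof -
    obtain b where b: "\<And>n. b n \<in> M" "b \<longlonglongrightarrow> y" using yM by (auto simp: closure_sequential)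
    have "\<forall>n. a n + b n \<in> M" using a b complex_vector.subspace_add[OF M] by blast
    then show ?thesis using tendsto_add[OF a(2) b(2)] unfolding closure_sequential
      by (intro exI[of _ "\<lambda>n. a n + b n"]) simp
  qed
  show "c *\<^sub>C x \<in> closure M" for c
  proof -
    have "\<forall>n. c *\<^sub>C a n \<in> M" using a complex_vector.subspace_scale[OF M] by blast
    then show ?thesis using bounded_linear.tendsto[OF bounded_linear_scaleC a(2)] unfolding closure_sequential
      by (intro exI[of _ "\<lambda>n. c *\<^sub>C a n"]) simp
  qed
qed

definition orthonormal :: "'a::complex_inner set \<Rightarrow> bool" where
  "orthonormal E \<longleftrightarrow> (\<forall>x\<in>E. \<forall>y\<in>E. cinner x y = (if x = y then 1 else 0))"

definition total_set :: "'a::complex_inner set \<Rightarrow> bool" where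
  "total_set E \<longleftrightarrow> closure (complex_vector.span E) = UNIV"

lemma total_set_induct:
  assumes "total_set E" "complex_vector.subspace S" "closed S" "E \<subseteq> S"
  shows "x \<in> S"
proof -
  have "closure (complex_vector.span E) \<subseteq> S"
    using assms by (intro closure_minimal complex_vector.span_minimal)
  then show ?thesis using assms(1) by (auto simp: total_set_def)
qed

lemma csubspace_orthogonal_right: "complex_vector.subspace {y. cinner x y = 0}"
  by (auto simp: complex_vector.subspace_def cinner_algebra)

lemma csubspace_orthogonal_left: "complex_vector.subspace {x. cinner x y = 0}"
  by (auto simp: complex_vector.subspace_def cinner_algebra)

text \<open>
  A maximal orthonormal set is total: a vector orthogonal to its closed span could be normalized
  and added.
\<close>

lemma orthonormal_basis_exists:
  obtains E :: "'a::chilbert_space set" where "orthonormal E" "total_set E"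
proof -
  have "\<exists>E\<in>{E :: 'a set. orthonormal E}. \<forall>X\<in>{E. orthonormal E}. E \<subseteq> X \<longrightarrow> X = E"
  proof (rule subset_Zorn')
    fix C :: "'a set set" assume C: "subset.chain {E. orthonormal E} C"
    have "cinner x y = (if x = y then 1 else 0)" if xy: "x \<in> \<Union>C" "y \<in> \<Union>C" for x y
    proof -
      obtain X Y where XY: "X \<in> C" "Y \<in> C" "x \<in> X" "y \<in> Y" using xy by blast
      then have "X \<subseteq> Y \<or> Y \<subseteq> X" "orthonormal X" "orthonormal Y"
        using C by (auto simp: subset.chain_def)
      then show ?thesis using XY unfolding orthonormal_def by blast
    qed
    then show "\<Union>C \<in> {E. orthonormal E}" by (simp add: orthonormal_def)
  qed
  then obtain E :: "'a set" where E: "orthonormal E" "\<And>X. orthonormal X \<Longrightarrow> E \<subseteq> X \<Longrightarrow> X = E"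
    by blast
  have "total_set E"
  proof (rule ccontr)
    assume "\<not> total_set E"
    then obtain z where z: "z \<noteq> 0" "\<And>y. y \<in> closure (complex_vector.span E) \<Longrightarrow> cinner y z = 0"
      unfolding total_set_def
      using orthogonal_vector_exists[OF csubspace_closure[OF complex_vector.subspace_span] closed_closure]
      by metis
    have zE: "cinner y z = 0" "cinner z y = 0" if "y \<in> E" for y
    proof -
      show "cinner y z = 0"
        using z(2) complex_vector.span_base[OF that] closure_subset by blast
      then show "cinner z y = 0" by (simp add: cinner_commute[of z y])
    qed
    define u where "u = (1 / norm z) *\<^sub>R z"
    have "cinner u u = 1" using z(1) by (simp add: u_def cinner_algebra cinner_self power2_eq_square)
    moreover have "cinner y u = 0 \<and> cinner u y = 0" if "y \<in> E" for y
      using zE[OF that] by (simp add: u_def cinner_algebra)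
    ultimately have "orthonormal (insert u E)" "u \<notin> E"
      using E(1) unfolding orthonormal_def by force+
    then show False using E(2) by blast
  qed
  then show thesis using that E(1) by blast
qed

text \<open>
  A finite total orthonormal set spans algebraically: subtracting from \<open>x\<close> its Fourier sum leaves a
  vector orthogonal to the set, hence zero.
\<close>

lemma orthonormal_basis_infinite:
  fixes E :: "'a::chilbert_space set"
  assumes E: "orthonormal E" "total_set E" and inf: "\<nexists>S :: 'a set. finite S \<and> complex_vector.span S = UNIV"
  shows "infinite E"
proof
  assume fin: "finite E"
  have "x \<in> complex_vector.span E" for x
  proof -
    define s where "s = (\<Sum>e\<in>E. cinner e x *\<^sub>C e)"
    have cinner_sum: "cinner y (\<Sum>e\<in>F. c e *\<^sub>C e) = (\<Sum>e\<in>F. c e * cinner y e)" for y c and F :: "'a set"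
      by (induction F rule: infinite_finite_induct) (simp_all add: cinner_algebra)
    have "cinner y (x - s) = 0" if "y \<in> E" for y
    proof -
      have "cinner y s = (\<Sum>e\<in>E. if y = e then cinner e x else 0)"
        unfolding s_def cinner_sum using E(1) that by (intro sum.cong) (auto simp: orthonormal_def)
      also have "\<dots> = cinner y x" using fin that by simp
      finally show ?thesis by (simp add: cinner_algebra)
    qed
    moreover have "closed {y. cinner y (x - s) = 0}"
      by (intro closed_Collect_eq continuous_intros)
    ultimately have "x - s \<in> {y. cinner y (x - s) = 0}"
      by (intro total_set_induct[OF E(2) csubspace_orthogonal_left]) auto
    then have "x = s" by (simp add: cinner_self)
    then show ?thesis
      unfolding s_def by (metis (no_types, lifting) complex_vector.span_base complex_vector.span_scale complex_vector.span_sum)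
  qed
  then show False using inf fin by blast
qed

text \<open>
  Orthonormal sets are linearly independent, so \<open>f\<close> extends linearly to the span. There it preserves
  inner products; hence it is uniformly continuous and extends to the closure.
\<close>

lemma isometry_extends:
  fixes E :: "'a::chilbert_space set"
  assumes E: "orthonormal E" "total_set E" and f: "inj_on f E" "f ` E \<subseteq> E"
  obtains S :: "'a operator" where "\<And>e. e \<in> E \<Longrightarrow> blinfun_apply S e = f e" "clinear_op S"
    "\<And>x y. cinner (blinfun_apply S x) (blinfun_apply S y) = cinner x y"
proof -
  interpret vp: vector_space_pair "scaleC :: complex \<Rightarrow> 'a \<Rightarrow> 'a" "scaleC :: complex \<Rightarrow> 'a \<Rightarrow> 'a"
    by unfold_locales
  have "\<not> complex_vector.dependent E"
    unfolding complex_vector.dependent_def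
  proof (rule notI, elim bexE)
    fix a assume a: "a \<in> E" "a \<in> complex_vector.span (E - {a})"
    have "complex_vector.span (E - {a}) \<subseteq> {y. cinner a y = 0}"
      using E(1) a(1) by (intro complex_vector.span_minimal csubspace_orthogonal_right) (auto simp: orthonormal_def)
    then have "cinner a a = 0" using a(2) by blast
    then show False using E(1) a(1) by (simp add: orthonormal_def)
  qed
  then obtain T where T: "Vector_Spaces.linear scaleC scaleC T" "\<And>e. e \<in> E \<Longrightarrow> T e = f e"
    using vp.linear_independent_extend[of E f] by blast
  have Tadd: "T (x + y) = T x + T y" and Tscale: "T (c *\<^sub>C x) = c *\<^sub>C T x" for x y c
    using T(1) vp.linear_add vp.linear_scale by blast+
  define X where "X = complex_vector.span E"
  have sub: "complex_vector.subspace X" by (simp add: X_def)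
  have dense: "closure X = UNIV" using E(2) by (simp add: X_def total_set_def)
  have sub_left: "complex_vector.subspace {x. cinner (T x) (T y) = cinner x y}" for y
    using Tscale[of 0 0] by (auto simp: complex_vector.subspace_def Tadd Tscale cinner_algebra)
  have sub_right: "complex_vector.subspace {y. cinner (T x) (T y) = cinner x y}" for x
    using Tscale[of 0 0] by (auto simp: complex_vector.subspace_def Tadd Tscale cinner_algebra)
  have "X \<subseteq> {x. cinner (T x) (T y) = cinner x y}" if "y \<in> E" for y
    unfolding X_def using E(1) f that
    by (intro complex_vector.span_minimal sub_left) (auto simp: orthonormal_def T inj_on_eq_iff image_subset_iff)
  then have "X \<subseteq> {y. cinner (T x) (T y) = cinner x y}" if "x \<in> X" for x
    unfolding X_def using that
    by (intro complex_vector.span_minimal sub_right) (auto simp: X_def)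
  then have iso: "cinner (T x) (T y) = cinner x y" if "x \<in> X" "y \<in> X" for x y
    using that by blast
  have iso_norm: "norm (T x) = norm x" if "x \<in> X" for x
  proof -
    have "(norm (T x))\<^sup>2 = (norm x)\<^sup>2"
      using arg_cong[OF iso[OF that that], of Re] by (simp add: cinner_self del: of_real_power)
    then show ?thesis by simp
  qed
  have Tdiff: "T (x - y) = T x - T y" for x y
    using vp.linear_diff[OF T(1)] .
  have "dist (T x) (T y) = dist x y" if "x \<in> X" "y \<in> X" for x y
    unfolding dist_norm Tdiff[symmetric] using that by (intro iso_norm complex_vector.subspace_diff sub)
  then have "uniformly_continuous_on X T"
    unfolding uniformly_continuous_on_def by metis
  then obtain g where g: "uniformly_continuous_on (closure X) g" "\<And>x. x \<in> X \<Longrightarrow> T x = g x"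
    using uniformly_continuous_on_extension_on_closure by metis
  have cont: "continuous_on UNIV g"
    using uniformly_continuous_imp_continuous[OF g(1)] by (simp add: dense)
  have contc: "continuous_on UNIV (\<lambda>x. g (h x))" if "continuous_on UNIV h" for h :: "'a \<Rightarrow> 'a"
    using continuous_on_compose2[OF cont that] by simp
  have density: "P x" if "closed {x. P x}" "\<And>x. x \<in> X \<Longrightarrow> P x" for P and x :: 'a
    using closure_minimal[of X "{x. P x}"] that dense by blast
  have gT: "g x = T x" if "x \<in> X" for x using g(2)[OF that] by simp
  have gadd: "g (x + y) = g x + g y" for x y
  proof (rule density[where P = "\<lambda>x. g (x + y) = g x + g y"])
    show "closed {x. g (x + y) = g x + g y}"
      by (intro closed_Collect_eq contc continuous_intros)
    fix x assume x: "x \<in> X"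
    show "g (x + y) = g x + g y"
    proof (rule density[where P = "\<lambda>y. g (x + y) = g x + g y"])
      show "closed {y. g (x + y) = g x + g y}"
        by (intro closed_Collect_eq contc continuous_intros)
      fix y assume "y \<in> X"
      then show "g (x + y) = g x + g y"
        using x complex_vector.subspace_add[OF sub] by (simp add: gT Tadd)
    qed
  qed
  have gscale: "g (c *\<^sub>C x) = c *\<^sub>C g x" for c x
  proof (rule density[where P = "\<lambda>x. g (c *\<^sub>C x) = c *\<^sub>C g x"])
    show "closed {x. g (c *\<^sub>C x) = c *\<^sub>C g x}"
      by (intro closed_Collect_eq contc continuous_intros)
    fix x assume "x \<in> X"
    then show "g (c *\<^sub>C x) = c *\<^sub>C g x"
      using complex_vector.subspace_scale[OF sub] by (simp add: gT Tscale)
  qed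
  have giso: "cinner (g x) (g y) = cinner x y" for x y
  proof (rule density[where P = "\<lambda>x. cinner (g x) (g y) = cinner x y"])
    show "closed {x. cinner (g x) (g y) = cinner x y}"
      by (intro closed_Collect_eq contc continuous_intros)
    fix x assume x: "x \<in> X"
    show "cinner (g x) (g y) = cinner x y"
    proof (rule density[where P = "\<lambda>y. cinner (g x) (g y) = cinner x y"])
      show "closed {y. cinner (g x) (g y) = cinner x y}"
        by (intro closed_Collect_eq contc continuous_intros)
    qed (use x in \<open>simp add: gT iso\<close>)
  qed
  have gnorm: "norm (g x) = norm x" for x
  proof -
    have "(norm (g x))\<^sup>2 = (norm x)\<^sup>2"
      using arg_cong[OF giso[of x x], of Re] by (simp add: cinner_self del: of_real_power)
    then show ?thesis by simp
  qed
  have bl: "bounded_linear g"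
    by (rule bounded_linear_intro[where K = 1]) (simp_all add: gadd scaleR_scaleC gscale gnorm)
  define S where "S = Blinfun g"
  have S: "blinfun_apply S = g" unfolding S_def by (rule bounded_linear_Blinfun_apply[OF bl])
  have "blinfun_apply S e = f e" if "e \<in> E" for e
    using gT[of e] T(2)[OF that] complex_vector.span_base[OF that] by (simp add: S X_def)
  moreover have "clinear_op S" by (simp add: clinear_op_def S gscale)
  ultimately show thesis using that giso S by metis
qed

section \<open>Splitting the space into two copies of itself\<close>

text \<open>
  Here \<open>V'\<close> and \<open>W'\<close> are the adjoints, and \<open>(x, y) \<mapsto> V x + W y\<close> is a unitary from \<open>H \<oplus> H\<close> onto \<open>H\<close>;
  these are the relations of the Cuntz algebra with two generators. The block diagonal operator
  \<open>X \<oplus> Y\<close> corresponds to \<open>V X V' + W Y W'\<close>.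
\<close>

definition cuntz_pair :: "'a::complex_inner operator \<Rightarrow> 'a operator \<Rightarrow> 'a operator \<Rightarrow> 'a operator \<Rightarrow> bool"
  where "cuntz_pair V V' W W' \<longleftrightarrow> adjoint_pair V V' \<and> adjoint_pair W W' \<and>
    V' o\<^sub>L V = id_blinfun \<and> W' o\<^sub>L W = id_blinfun \<and> V' o\<^sub>L W = 0 \<and> W' o\<^sub>L V = 0 \<and>
    (V o\<^sub>L V') + (W o\<^sub>L W') = id_blinfun"

lemma cuntz_pairD:
  assumes "cuntz_pair V V' W W'"
  shows "adjoint_pair V V'" "adjoint_pair W W'"
    "blinfun_apply V' (blinfun_apply V x) = x" "blinfun_apply W' (blinfun_apply W x) = x"
    "blinfun_apply V' (blinfun_apply W x) = 0" "blinfun_apply W' (blinfun_apply V x) = 0"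
    "blinfun_apply V (blinfun_apply V' x) + blinfun_apply W (blinfun_apply W' x) = x"
proof -
  show "adjoint_pair V V'" "adjoint_pair W W'" using assms by (auto simp: cuntz_pair_def)
  have *: "V' o\<^sub>L V = id_blinfun" "W' o\<^sub>L W = id_blinfun" "V' o\<^sub>L W = 0" "W' o\<^sub>L V = 0"
    "(V o\<^sub>L V') + (W o\<^sub>L W') = id_blinfun" using assms by (auto simp: cuntz_pair_def)
  note ** = *[THEN arg_cong, of "\<lambda>U. blinfun_apply U x"]
  show "blinfun_apply V' (blinfun_apply V x) = x" "blinfun_apply W' (blinfun_apply W x) = x"
    "blinfun_apply V' (blinfun_apply W x) = 0" "blinfun_apply W' (blinfun_apply V x) = 0"
    "blinfun_apply V (blinfun_apply V' x) + blinfun_apply W (blinfun_apply W' x) = x"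
    using ** by (simp_all add: blinfun.add_left)
qed

lemma cuntz_pairI:
  assumes "adjoint_pair V V'" "adjoint_pair W W'"
    "\<And>x. blinfun_apply V' (blinfun_apply V x) = x" "\<And>x. blinfun_apply W' (blinfun_apply W x) = x"
    "\<And>x. blinfun_apply V' (blinfun_apply W x) = 0"
    "\<And>x. blinfun_apply V (blinfun_apply V' x) + blinfun_apply W (blinfun_apply W' x) = x"
  shows "cuntz_pair V V' W W'"
proof -
  have "blinfun_apply W' (blinfun_apply V x) = 0" for x
  proof (rule cinner_eqI)
    fix y
    have "cinner y (blinfun_apply W' (blinfun_apply V x)) = cinner (blinfun_apply V' (blinfun_apply W y)) x"
      using assms(1,2) by (metis adjoint_pairD adjoint_pair_sym)
    then show "cinner y (blinfun_apply W' (blinfun_apply V x)) = cinner y 0" by (simp add: assms)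
  qed
  then show ?thesis
    unfolding cuntz_pair_def using assms by (auto intro!: blinfun_eqI simp: blinfun.add_left)
qed

lemma isometries_orthogonal_ranges:
  fixes E :: "'a::chilbert_space set"
  assumes "total_set E" "clinear_op S" "clinear_op T"
    and "\<And>e e'. e \<in> E \<Longrightarrow> e' \<in> E \<Longrightarrow> cinner (blinfun_apply S e) (blinfun_apply T e') = 0"
  shows "cinner (blinfun_apply S x) (blinfun_apply T y) = 0"
proof -
  have lin: "blinfun_apply S (c *\<^sub>C x) = c *\<^sub>C blinfun_apply S x"
    "blinfun_apply T (c *\<^sub>C x) = c *\<^sub>C blinfun_apply T x" for c x
    using assms(2,3) by (auto simp: clinear_op_def)
  have "cinner (blinfun_apply S x) (blinfun_apply T e) = 0" if "e \<in> E" for x e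
  proof -
    have "x \<in> {x. cinner (blinfun_apply S x) (blinfun_apply T e) = 0}"
      using assms(4) that
      by (intro total_set_induct[OF assms(1)] closed_Collect_eq continuous_intros)
        (auto simp: complex_vector.subspace_def lin blinfun.add_right cinner_algebra)
    then show ?thesis by blast
  qed
  then have "y \<in> {y. cinner (blinfun_apply S x) (blinfun_apply T y) = 0}"
    by (intro total_set_induct[OF assms(1)] closed_Collect_eq continuous_intros)
      (auto simp: complex_vector.subspace_def lin blinfun.add_right cinner_algebra)
  then show ?thesis by blast
qed

text \<open>
  A bijection between the disjoint sum of two copies of the basis and the basis splits the latter
  into two halves, each of which is an isometric image of the whole.
\<close>

lemma cuntz_pair_exists:
  assumes inf: "\<nexists>S :: 'a::chilbert_space set. finite S \<and> complex_vector.span S = UNIV"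
  obtains V V' W W' :: "'a::chilbert_space operator" where "cuntz_pair V V' W W'"
proof -
  obtain E :: "'a set" where E: "orthonormal E" "total_set E" using orthonormal_basis_exists .
  have "infinite E" by (rule orthonormal_basis_infinite[OF E inf])
  then obtain g where g: "bij_betw g (E <+> E) E"
    using card_of_Plus_infinite1[of E E] card_of_ordIso card_of_mono1[OF subset_refl] by blast
  have gE: "g (Inl e) \<in> E" "g (Inr e) \<in> E" if "e \<in> E" for e
    using g that by (auto simp: bij_betw_def)
  have ginj: "g a = g b \<longleftrightarrow> a = b" if "a \<in> E <+> E" "b \<in> E <+> E" for a b
    using inj_on_eq_iff[OF bij_betw_imp_inj_on[OF g] that] .
  obtain V where V: "\<And>e. e \<in> E \<Longrightarrow> blinfun_apply V e = g (Inl e)" "clinear_op V"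
    "\<And>x y. cinner (blinfun_apply V x) (blinfun_apply V y) = cinner x y"
    using isometry_extends[OF E, of "\<lambda>e. g (Inl e)"] gE ginj
    by (smt (verit) InlI Inl_inject image_subset_iff inj_onI)
  obtain W where W: "\<And>e. e \<in> E \<Longrightarrow> blinfun_apply W e = g (Inr e)" "clinear_op W"
    "\<And>x y. cinner (blinfun_apply W x) (blinfun_apply W y) = cinner x y"
    using isometry_extends[OF E, of "\<lambda>e. g (Inr e)"] gE ginj
    by (smt (verit) InrI Inr_inject image_subset_iff inj_onI)
  have VW: "cinner (blinfun_apply V x) (blinfun_apply W y) = 0" for x y
  proof (rule isometries_orthogonal_ranges[OF E(2) V(2) W(2)])
    fix e e' assume e: "e \<in> E" "e' \<in> E"
    then have "g (Inl e) \<noteq> g (Inr e')" using ginj by auto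
    then show "cinner (blinfun_apply V e) (blinfun_apply W e') = 0"
      using e gE E(1) by (simp add: V W orthonormal_def)
  qed
  have WV: "cinner (blinfun_apply W x) (blinfun_apply V y) = 0" for x y
    using VW[of y x] by (simp add: cinner_commute[of "blinfun_apply W x"])
  \<comment> \<open>The ranges add up to \<open>H\<close>: their sum is the image of an isometry, hence complete and closed, and
    it contains the basis.\<close>
  define h where "h = (\<lambda>(x, y). blinfun_apply V x + blinfun_apply W y)"
  have bl: "bounded_linear h"
    unfolding h_def case_prod_beta
    by (intro bounded_linear_add bounded_linear_blinfun_apply bounded_linear_fst bounded_linear_snd)
  have "norm (h p) = norm p" for p
  proof -
    have "(norm (h p))\<^sup>2 = (norm p)\<^sup>2"
      unfolding h_def case_prod_beta power2_norm_eq_inner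
      by (simp add: Re_cinner[symmetric] cinner_algebra V W VW WV inner_prod_def)
    then show ?thesis by simp
  qed
  then have "complete (h ` UNIV)"
    by (intro complete_isometric_image[of 1] bl complete_UNIV) auto
  then have "closed (range h)" by (rule complete_imp_closed)
  moreover have "complex_vector.subspace (range h)"
    unfolding complex_vector.subspace_def
  proof (intro conjI ballI allI)
    show "0 \<in> range h" by (rule range_eqI[of _ _ "(0, 0)"]) (simp add: h_def)
    fix a assume "a \<in> range h"
    then obtain x y where a: "a = h (x, y)" by auto
    show "a + b \<in> range h" if b: "b \<in> range h" for b
    proof -
      obtain x' y' where "b = h (x', y')" using b by auto
      then show ?thesis
        by (intro range_eqI[of _ _ "(x + x', y + y')"]) (simp add: a h_def blinfun.add_right)
    qed
    show "c *\<^sub>C a \<in> range h" for c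
      using V(2) W(2) by (intro range_eqI[of _ _ "(c *\<^sub>C x, c *\<^sub>C y)"])
        (simp add: a h_def clinear_op_def scaleC_add_right)
  qed
  moreover have "E \<subseteq> range h"
  proof
    fix e assume "e \<in> E"
    then obtain p where p: "p \<in> E <+> E" "e = g p" using g by (auto simp: bij_betw_def)
    show "e \<in> range h"
    proof (cases p)
      case (Inl a)
      then have "e = h (a, 0)" using p by (auto simp: h_def V)
      then show ?thesis by blast
    next
      case (Inr a)
      then have "e = h (0, a)" using p by (auto simp: h_def W)
      then show ?thesis by blast
    qed
  qed
  ultimately have "z \<in> range h" for z by (blast intro: total_set_induct[OF E(2)])
  then have "\<exists>x y. z = blinfun_apply V x + blinfun_apply W y" for z
    by (auto simp: h_def image_iff)
  then obtain p q where pq: "\<And>z. z = blinfun_apply V (p z) + blinfun_apply W (q z)" by metis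
  have padj: "cinner (blinfun_apply V x) z = cinner x (p z)" for x z
    by (subst pq[of z]) (simp add: cinner_algebra V VW)
  have qadj: "cinner (blinfun_apply W x) z = cinner x (q z)" for x z
    by (subst pq[of z]) (simp add: cinner_algebra W WV)
  \<comment> \<open>The coordinates \<open>p\<close> and \<open>q\<close> are the adjoints; boundedness follows from the adjoint relation.\<close>
  have isometry_adjoint: "bounded_linear r"
    if r: "\<And>x z. cinner (blinfun_apply U x) z = cinner x (r z)"
      and U: "\<And>x y. cinner (blinfun_apply U x) (blinfun_apply U y) = cinner x y"
    for U :: "'a operator" and r
  proof (rule bounded_linear_intro[where K = 1])
    show "r (x + y) = r x + r y" for x y
      by (rule cinner_eqI) (simp add: r[symmetric] cinner_algebra)
    show "r (c *\<^sub>R x) = c *\<^sub>R r x" for c x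
      by (rule cinner_eqI) (simp add: r[symmetric] cinner_algebra)
    fix z
    have nU: "norm (blinfun_apply U x) = norm x" for x
      using arg_cong[OF U[of x x], of Re] by (simp add: Re_cinner norm_eq_sqrt_inner)
    have "norm (r z) * norm (r z) = inner (blinfun_apply U (r z)) z"
      using arg_cong[OF r[of "r z" z], of Re] by (simp add: Re_cinner power2_norm_eq_inner[symmetric] power2_eq_square)
    also have "\<dots> \<le> norm (r z) * norm z"
      using norm_cauchy_schwarz[of "blinfun_apply U (r z)" z] by (simp add: nU)
    finally show "norm (r z) \<le> norm z * 1"
      by (cases "r z = 0") auto
  qed
  have p: "blinfun_apply (Blinfun p) = p" and q: "blinfun_apply (Blinfun q) = q"
    using isometry_adjoint[OF padj V(3)] isometry_adjoint[OF qadj W(3)]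
    by (auto intro: bounded_linear_Blinfun_apply)
  have "cuntz_pair V (Blinfun p) W (Blinfun q)"
  proof (rule cuntz_pairI)
    show "adjoint_pair V (Blinfun p)" "adjoint_pair W (Blinfun q)"
      by (auto simp: adjoint_pair_def p q padj qadj)
    fix x
    show "blinfun_apply (Blinfun p) (blinfun_apply V x) = x"
      unfolding p by (rule cinner_eqI) (simp add: padj[symmetric] V)
    show "blinfun_apply (Blinfun q) (blinfun_apply W x) = x"
      unfolding q by (rule cinner_eqI) (simp add: qadj[symmetric] W)
    show "blinfun_apply (Blinfun p) (blinfun_apply W x) = 0"
      unfolding p by (rule cinner_eqI) (simp add: padj[symmetric] VW)
    show "blinfun_apply V (blinfun_apply (Blinfun p) x) + blinfun_apply W (blinfun_apply (Blinfun q) x) = x"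
      unfolding p q using pq[of x] by simp
  qed
  then show thesis by (rule that)
qed

section \<open>Regular maps\<close>

text \<open>
  With \<open>\<parallel>z\<parallel>\<^sup>2 = \<parallel>V' z\<parallel>\<^sup>2 + \<parallel>W' z\<parallel>\<^sup>2\<close>, the smaller of the two coercivity constants works for the sum.
\<close>

lemma pos_def_block:
  fixes V :: "'a::complex_inner operator"
  assumes c: "cuntz_pair V V' W W'" and X: "pos_def X" and Y: "pos_def Y"
  shows "pos_def ((V o\<^sub>L X o\<^sub>L V') + (W o\<^sub>L Y o\<^sub>L W'))"
proof -
  note C = cuntz_pairD[OF c]
  obtain d where d: "0 < d" "\<And>x. d * (norm x)\<^sup>2 \<le> inner x (blinfun_apply X x)"
    using pos_defE[OF X] by blast
  obtain e where e: "0 < e" "\<And>x. e * (norm x)\<^sup>2 \<le> inner x (blinfun_apply Y x)"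
    using pos_defE[OF Y] by blast
  have "min d e * (norm z)\<^sup>2 \<le> inner z (blinfun_apply ((V o\<^sub>L X o\<^sub>L V') + (W o\<^sub>L Y o\<^sub>L W')) z)" for z
  proof -
    let ?a = "blinfun_apply V' z" and ?b = "blinfun_apply W' z"
    have "(norm z)\<^sup>2 = inner z (blinfun_apply V ?a + blinfun_apply W ?b)"
      by (simp add: C(7) power2_norm_eq_inner)
    also have "\<dots> = (norm ?a)\<^sup>2 + (norm ?b)\<^sup>2"
      using adjoint_pair_inner[OF adjoint_pair_sym[OF C(1)]] adjoint_pair_inner[OF adjoint_pair_sym[OF C(2)]]
      by (simp add: inner_add_right power2_norm_eq_inner)
    finally have "min d e * (norm z)\<^sup>2 = min d e * (norm ?a)\<^sup>2 + min d e * (norm ?b)\<^sup>2"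
      by (simp add: distrib_left)
    also have "\<dots> \<le> d * (norm ?a)\<^sup>2 + e * (norm ?b)\<^sup>2"
      by (intro add_mono mult_right_mono) auto
    also have "\<dots> \<le> inner ?a (blinfun_apply X ?a) + inner ?b (blinfun_apply Y ?b)"
      by (intro add_mono d e)
    also have "\<dots> = inner z (blinfun_apply ((V o\<^sub>L X o\<^sub>L V') + (W o\<^sub>L Y o\<^sub>L W')) z)"
      using adjoint_pair_inner[OF adjoint_pair_sym[OF C(1)]] adjoint_pair_inner[OF adjoint_pair_sym[OF C(2)]]
      by (simp add: blinfun.add_left inner_add_right)
    finally show ?thesis .
  qed
  moreover have "0 < min d e" using d e by simp
  moreover have "adjoint_pair (V o\<^sub>L X o\<^sub>L V') (V o\<^sub>L X o\<^sub>L V')" "adjoint_pair (W o\<^sub>L Y o\<^sub>L W') (W o\<^sub>L Y o\<^sub>L W')"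
    using pos_def_selfadjoint[OF X] pos_def_selfadjoint[OF Y] C(1,2) adjoint_pair_sym[OF C(1)] adjoint_pair_sym[OF C(2)]
    by (simp_all add: adjoint_pair_def)
  ultimately show ?thesis unfolding pos_def_def by (blast intro: adjoint_pair_add)
qed

lemma cuntz_pair_swap: "cuntz_pair V V' W W' \<Longrightarrow> cuntz_pair W W' V V'"
  by (auto simp: cuntz_pair_def add.commute)

text \<open>
  Describing the range as a kernel shows that it is a closed complex subspace.
\<close>

lemma cuntz_pair_range:
  assumes "cuntz_pair V V' W W'"
  shows "range (blinfun_apply V) = {z. blinfun_apply W' z = 0}"
proof safe
  fix z assume "blinfun_apply W' z = 0"
  then have "z = blinfun_apply V (blinfun_apply V' z)" using cuntz_pairD(7)[OF assms, of z] by simp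
  then show "z \<in> range (blinfun_apply V)" by blast
qed (simp add: cuntz_pairD[OF assms])

lemma cuntz_pair_isometry:
  assumes "cuntz_pair V V' W W'"
  shows "cinner (blinfun_apply V x) (blinfun_apply V y) = cinner x y"
  using adjoint_pairD[OF cuntz_pairD(1)[OF assms]] cuntz_pairD(3)[OF assms] by simp

lemma cuntz_pair_range_closed_csubspace:
  fixes V :: "'a::complex_inner operator"
  assumes c: "cuntz_pair V V' W W'" and nontriv: "(UNIV :: 'a set) \<noteq> {0}"
  shows "range (blinfun_apply V) \<in> closed_csubspaces"
proof -
  have "clinear_op W'" using adjoint_pair_clinear[OF adjoint_pair_sym[OF cuntz_pairD(2)[OF c]]] .
  then have "complex_vector.subspace {z. blinfun_apply W' z = 0}"
    by (auto simp: complex_vector.subspace_def clinear_op_def blinfun.add_right)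
  moreover have "closed {z. blinfun_apply W' z = 0}"
    by (intro closed_Collect_eq continuous_intros)
  moreover have "range (blinfun_apply V) \<noteq> {0}"
  proof
    assume "range (blinfun_apply V) = {0}"
    then have "blinfun_apply V x = 0" for x by (metis rangeI singletonD)
    then have "x = 0" for x :: 'a using cuntz_pairD(3)[OF c, of x] by simp
    then show False using nontriv by blast
  qed
  ultimately show ?thesis unfolding closed_csubspaces_def cuntz_pair_range[OF c] by blast
qed

lemma cuntz_pair_unitary_between:
  fixes V :: "'a::complex_inner operator"
  assumes c: "cuntz_pair V V' W W'"
  shows "unitary_between UNIV (range (blinfun_apply V)) V"
  unfolding unitary_between_def ortho_UNIV
  using adjoint_pair_clinear[OF cuntz_pairD(1)[OF c]] cuntz_pair_isometry[OF c] by simp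

lemma cuntz_pair_transport_pos_tuples:
  fixes xs :: "'a::chilbert_space operator list"
  assumes c: "cuntz_pair V V' W W'" and xs: "xs \<in> pos_tuples k UNIV"
  shows "map (\<lambda>x. V o\<^sub>L x o\<^sub>L V') xs \<in> pos_tuples k (range (blinfun_apply V))"
proof -
  let ?K = "range (blinfun_apply V)"
  note C = cuntz_pairD[OF c]
  have lin: "clinear_op V" "clinear_op V'"
    using adjoint_pair_clinear[OF C(1)] adjoint_pair_clinear[OF adjoint_pair_sym[OF C(1)]] by auto
  have ops: "V o\<^sub>L x o\<^sub>L V' \<in> bounded_ops ?K" if "clinear_op x" for x
  proof -
    have "blinfun_apply V' z = 0" if "z \<in> ortho ?K" for z
    proof (rule cinner_eqI)
      fix y
      show "cinner y (blinfun_apply V' z) = cinner y 0"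
        using that adjoint_pairD[OF C(1), of y z] by (auto simp: ortho_def)
    qed
    then show ?thesis
      using that lin by (auto simp: bounded_ops_def intro!: clinear_op_compose)
  qed
  have "V o\<^sub>L x o\<^sub>L V' \<in> bounded_ops ?K \<and> positive_op (V o\<^sub>L x o\<^sub>L V') \<and> invertible_in ?K (V o\<^sub>L x o\<^sub>L V')"
    if "x \<in> set xs" for x
  proof (intro conjI)
    have x: "pos_def x" using xs that by (simp add: pos_tuples_UNIV)
    then show "V o\<^sub>L x o\<^sub>L V' \<in> bounded_ops ?K"
      by (intro ops adjoint_pair_clinear[OF pos_def_selfadjoint])
    show "positive_op (V o\<^sub>L x o\<^sub>L V')"
      using pos_def_imp_positive_op[OF x]
      by (simp add: positive_op_def flip: adjoint_pairD[OF adjoint_pair_sym[OF C(1)]])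
    obtain y where y: "pos_def y" "\<And>z. blinfun_apply y (blinfun_apply x z) = z"
      "\<And>z. blinfun_apply x (blinfun_apply y z) = z" using pos_def_inverse[OF x] by blast
    have "V o\<^sub>L y o\<^sub>L V' \<in> bounded_ops ?K"
      using y(1) by (intro ops adjoint_pair_clinear[OF pos_def_selfadjoint])
    then show "invertible_in ?K (V o\<^sub>L x o\<^sub>L V')"
      unfolding invertible_in_def by (intro bexI[of _ "V o\<^sub>L y o\<^sub>L V'"]) (auto simp: C y)
  qed
  then show ?thesis using xs by (auto simp: pos_tuples_def)
qed

lemma UNIV_closed_csubspace: "(UNIV :: 'a::complex_inner set) \<noteq> {0} \<Longrightarrow> (UNIV :: 'a set) \<in> closed_csubspaces"
  by (simp add: closed_csubspaces_def)

lemma block_pos_tuples: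
  fixes xs ys :: "'a::chilbert_space operator list"
  assumes c: "cuntz_pair V V' W W'" and xs: "xs \<in> pos_tuples k UNIV" and ys: "ys \<in> pos_tuples k UNIV"
  shows "map2 (\<lambda>x y. (V o\<^sub>L x o\<^sub>L V') + (W o\<^sub>L y o\<^sub>L W')) xs ys \<in> pos_tuples k UNIV"
  using xs ys unfolding pos_tuples_UNIV
  by (auto intro!: pos_def_block[OF c] dest: set_zip_leftD set_zip_rightD)

text \<open>
  \<open>V\<close> and \<open>W\<close> are unitaries from \<open>H\<close> onto two orthogonal subspaces with sum \<open>H\<close>. Unitary invariance
  moves \<open>F\<close> onto each of them, and the block diagonal rule puts the pieces together.
\<close>

lemma regular_map_block:
  fixes F :: "'a::chilbert_space operator list \<Rightarrow> 'a operator"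
  assumes F: "regular_map k F" and nontriv: "(UNIV :: 'a set) \<noteq> {0}"
    and c: "cuntz_pair V V' W W'" and xs: "xs \<in> pos_tuples k UNIV" and ys: "ys \<in> pos_tuples k UNIV"
  shows "F (map2 (\<lambda>x y. (V o\<^sub>L x o\<^sub>L V') + (W o\<^sub>L y o\<^sub>L W')) xs ys)
    = (V o\<^sub>L F xs o\<^sub>L V') + (W o\<^sub>L F ys o\<^sub>L W')"
proof -
  let ?K = "range (blinfun_apply V)" and ?L = "range (blinfun_apply W)"
  note c' = cuntz_pair_swap[OF c]
  note C = cuntz_pairD[OF c]
  obtain G where G: "\<forall>xs\<in>pos_tuples k UNIV. G UNIV xs = F xs"
    "\<forall>K\<in>closed_csubspaces. \<forall>L\<in>closed_csubspaces. \<forall>u. unitary_between K L u \<longrightarrow>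
       (\<forall>xs\<in>pos_tuples k K.
          G L (map (\<lambda>x. u o\<^sub>L x o\<^sub>L op_adj u) xs) = u o\<^sub>L G K xs o\<^sub>L op_adj u)"
    "\<forall>K\<in>closed_csubspaces. \<forall>L\<in>closed_csubspaces. (\<forall>x\<in>K. \<forall>y\<in>L. cinner x y = 0) \<longrightarrow>
       (\<forall>xs\<in>pos_tuples k K. \<forall>ys\<in>pos_tuples k L.
          G {x + y |x y. x \<in> K \<and> y \<in> L} (map2 (+) xs ys) = G K xs + G L ys)"
    using F unfolding regular_map_def by (elim exE conjE) (rule that)
  note G = G[rule_format]
  note KL = cuntz_pair_range_closed_csubspace[OF c nontriv] cuntz_pair_range_closed_csubspace[OF c' nontriv]
  have GK: "G ?K (map (\<lambda>x. V o\<^sub>L x o\<^sub>L V') xs) = V o\<^sub>L F xs o\<^sub>L V'"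
    using G(2)[OF UNIV_closed_csubspace[OF nontriv] KL(1) cuntz_pair_unitary_between[OF c] xs]
    by (simp add: op_adj_eqI[OF C(1)] G(1)[OF xs])
  have GL: "G ?L (map (\<lambda>x. W o\<^sub>L x o\<^sub>L W') ys) = W o\<^sub>L F ys o\<^sub>L W'"
    using G(2)[OF UNIV_closed_csubspace[OF nontriv] KL(2) cuntz_pair_unitary_between[OF c'] ys]
    by (simp add: op_adj_eqI[OF C(2)] G(1)[OF ys])
  have orth: "cinner x y = 0" if "x \<in> ?K" "y \<in> ?L" for x y
    using that adjoint_pairD[OF C(1)] C(5) by auto
  have sum: "{x + y |x y. x \<in> ?K \<and> y \<in> ?L} = UNIV"
  proof (rule sym, rule UNIV_eq_I)
    fix z
    show "z \<in> {x + y |x y. x \<in> ?K \<and> y \<in> ?L}" using C(7)[of z, symmetric] by blast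
  qed
  have len: "length xs = length ys" using xs ys by (simp add: pos_tuples_def)
  have "map2 (+) (map (\<lambda>x. V o\<^sub>L x o\<^sub>L V') xs) (map (\<lambda>x. W o\<^sub>L x o\<^sub>L W') ys)
      = map2 (\<lambda>x y. (V o\<^sub>L x o\<^sub>L V') + (W o\<^sub>L y o\<^sub>L W')) xs ys"
    using len by (intro nth_equalityI) auto
  then show ?thesis
    using G(3)[OF KL orth cuntz_pair_transport_pos_tuples[OF c xs] cuntz_pair_transport_pos_tuples[OF c' ys]]
      G(1)[OF block_pos_tuples[OF c xs ys]]
    unfolding sum GK GL by simp
qed

lemma regular_map_unitary:
  fixes F :: "'a::chilbert_space operator list \<Rightarrow> 'a operator"
  assumes F: "regular_map k F" and nontriv: "(UNIV :: 'a set) \<noteq> {0}"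
    and U: "adjoint_pair U U'" "\<And>x. blinfun_apply U' (blinfun_apply U x) = x"
      "\<And>x. blinfun_apply U (blinfun_apply U' x) = x"
    and xs: "xs \<in> pos_tuples k UNIV"
  shows "map (\<lambda>x. U o\<^sub>L x o\<^sub>L U') xs \<in> pos_tuples k UNIV"
    "F (map (\<lambda>x. U o\<^sub>L x o\<^sub>L U') xs) = U o\<^sub>L F xs o\<^sub>L U'"
proof -
  show pos: "map (\<lambda>x. U o\<^sub>L x o\<^sub>L U') xs \<in> pos_tuples k UNIV"
    using xs pos_def_congruence[OF _ adjoint_pair_sym[OF U(1)] U(3)] by (auto simp: pos_tuples_UNIV)
  have "surj (blinfun_apply U)" using U(3) by (rule surjI)
  then have "unitary_between UNIV UNIV U"
    unfolding unitary_between_def ortho_UNIV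
    using adjoint_pair_clinear[OF U(1)] adjoint_pairD[OF U(1)] U(2) by simp
  moreover obtain G where G: "\<forall>xs\<in>pos_tuples k UNIV. G UNIV xs = F xs"
    "\<forall>K\<in>closed_csubspaces. \<forall>L\<in>closed_csubspaces. \<forall>u. unitary_between K L u \<longrightarrow>
       (\<forall>xs\<in>pos_tuples k K.
          G L (map (\<lambda>x. u o\<^sub>L x o\<^sub>L op_adj u) xs) = u o\<^sub>L G K xs o\<^sub>L op_adj u)"
    using F unfolding regular_map_def by (elim exE conjE) (rule that)
  moreover note UNIV_closed_csubspace[OF nontriv]
  ultimately have "G UNIV (map (\<lambda>x. U o\<^sub>L x o\<^sub>L op_adj U) xs) = U o\<^sub>L G UNIV xs o\<^sub>L op_adj U"
    using xs by blast
  then show "F (map (\<lambda>x. U o\<^sub>L x o\<^sub>L U') xs) = U o\<^sub>L F xs o\<^sub>L U'"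
    unfolding op_adj_eqI[OF U(1)] using G(1) xs pos by simp
qed

section \<open>Jensen's operator inequality for convex regular maps\<close>

lemma op_le_congruence:
  assumes "op_le S T" "adjoint_pair M N"
  shows "op_le (N o\<^sub>L S o\<^sub>L M) (N o\<^sub>L T o\<^sub>L M)"
proof -
  have "cinner x (blinfun_apply ((N o\<^sub>L T o\<^sub>L M) - (N o\<^sub>L S o\<^sub>L M)) x)
      = cinner (blinfun_apply M x) (blinfun_apply (T - S) (blinfun_apply M x))" for x
    by (simp add: adjoint_pairD[OF assms(2)] blinfun.diff_left blinfun.diff_right)
  then show ?thesis using assms(1) unfolding op_le_def positive_op_def by simp
qed

text \<open>
  The algebra behind averaging an operator \<open>z\<close> with its conjugate by the reflection \<open>J\<close> of a pair:
  \<open>u\<close>, \<open>v\<close>, \<open>w\<close>, \<open>y\<close> are the images of a vector under the four blocks of \<open>z\<close>, of which the two diagonal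
  ones survive.
\<close>

lemma pinching_identity:
  fixes u v w y :: "'a::real_vector"
  shows "(1/2) *\<^sub>R ((u + v) + (w + y)) + (1/2) *\<^sub>R ((u - w) - (v - y)) = u + y"
proof -
  have "((u + v) + (w + y)) + ((u - w) - (v - y)) = 2 *\<^sub>R (u + y)"
    by (simp add: scaleR_2 algebra_simps)
  then show ?thesis by (simp flip: scaleR_add_right)
qed

text \<open>
  Convexity at the midpoint of \<open>zs\<close> and its conjugate by the unitary \<open>J = V V' - W W'\<close>. The midpoint is
  block diagonal, so \<open>regular_map_block\<close> evaluates \<open>F\<close> on it, while \<open>F\<close> at the conjugate is the
  conjugate of \<open>F zs\<close>. Both values have the same compression by \<open>V\<close>, since
  \<open>J V = V\<close>.
\<close>

lemma regular_map_compression: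
  fixes F :: "'a::chilbert_space operator list \<Rightarrow> 'a operator"
  assumes F: "regular_map k F" "convex_op_map k F" and nontriv: "(UNIV :: 'a set) \<noteq> {0}"
    and c: "cuntz_pair V V' W W'" and zs: "zs \<in> pos_tuples k UNIV"
  shows "op_le (F (map (\<lambda>z. V' o\<^sub>L z o\<^sub>L V) zs)) (V' o\<^sub>L F zs o\<^sub>L V)"
proof -
  note C = cuntz_pairD[OF c]
  define J where "J = (V o\<^sub>L V') - (W o\<^sub>L W')"
  have J: "blinfun_apply J x = blinfun_apply V (blinfun_apply V' x) - blinfun_apply W (blinfun_apply W' x)" for x
    by (simp add: J_def blinfun.diff_left)
  have JJ: "blinfun_apply J (blinfun_apply J x) = x" for x
    by (simp add: J blinfun.diff_right C)
  have Jadj: "adjoint_pair J J"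
    unfolding J_def using C(1,2) by (intro adjoint_pair_diff) (auto intro: adjoint_pair_compose adjoint_pair_sym)
  let ?zs' = "map (\<lambda>z. J o\<^sub>L z o\<^sub>L J) zs"
  note U = regular_map_unitary[OF F(1) nontriv Jadj JJ JJ zs]
  have comp: "map (\<lambda>z. V' o\<^sub>L z o\<^sub>L V) zs \<in> pos_tuples k UNIV" "map (\<lambda>z. W' o\<^sub>L z o\<^sub>L W) zs \<in> pos_tuples k UNIV"
    using zs pos_def_congruence[OF _ C(1) C(3)] pos_def_congruence[OF _ C(2) C(4)] by (auto simp: pos_tuples_UNIV)
  have pinch: "(1/2) *\<^sub>R z + (1 - 1/2) *\<^sub>R (J o\<^sub>L z o\<^sub>L J)
      = (V o\<^sub>L (V' o\<^sub>L z o\<^sub>L V) o\<^sub>L V') + (W o\<^sub>L (W' o\<^sub>L z o\<^sub>L W) o\<^sub>L W')" for z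
  proof (rule blinfun_eqI)
    fix x
    define a where "a = blinfun_apply z (blinfun_apply V (blinfun_apply V' x))"
    define b where "b = blinfun_apply z (blinfun_apply W (blinfun_apply W' x))"
    let ?P = "\<lambda>y. blinfun_apply V (blinfun_apply V' y)" and ?Q = "\<lambda>y. blinfun_apply W (blinfun_apply W' y)"
    have zx: "blinfun_apply z x = (?P a + ?Q a) + (?P b + ?Q b)"
      by (simp only: C(7) a_def b_def blinfun.add_right[symmetric])
    have "blinfun_apply (J o\<^sub>L z o\<^sub>L J) x = (?P a - ?P b) - (?Q a - ?Q b)"
      by (simp add: J blinfun.diff_right a_def b_def)
    then show "blinfun_apply ((1/2) *\<^sub>R z + (1 - 1/2) *\<^sub>R (J o\<^sub>L z o\<^sub>L J)) x
      = blinfun_apply ((V o\<^sub>L (V' o\<^sub>L z o\<^sub>L V) o\<^sub>L V') + (W o\<^sub>L (W' o\<^sub>L z o\<^sub>L W) o\<^sub>L W')) x"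
      using pinching_identity[of "?P a" "?Q a" "?P b" "?Q b"] zx
      by (simp add: blinfun.add_left blinfun.scaleR_left a_def[symmetric] b_def[symmetric] del: scaleR_right_diff_distrib)
  qed
  have mix: "map2 (\<lambda>A B. (1/2) *\<^sub>R A + (1 - 1/2) *\<^sub>R B) zs ?zs'
      = map2 (\<lambda>x y. (V o\<^sub>L x o\<^sub>L V') + (W o\<^sub>L y o\<^sub>L W')) (map (\<lambda>z. V' o\<^sub>L z o\<^sub>L V) zs) (map (\<lambda>z. W' o\<^sub>L z o\<^sub>L W) zs)"
    by (intro nth_equalityI) (simp_all only: length_map length_zip nth_map nth_zip min.idem prod.case pinch)
  have "op_le (F (map2 (\<lambda>A B. (1/2) *\<^sub>R A + (1 - 1/2) *\<^sub>R B) zs ?zs')) ((1/2) *\<^sub>R F zs + (1 - 1/2) *\<^sub>R F ?zs')"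
    by (rule F(2)[unfolded convex_op_map_def, rule_format, OF zs U(1)]) simp
  then have "op_le ((V o\<^sub>L F (map (\<lambda>z. V' o\<^sub>L z o\<^sub>L V) zs) o\<^sub>L V') + (W o\<^sub>L F (map (\<lambda>z. W' o\<^sub>L z o\<^sub>L W) zs) o\<^sub>L W'))
      ((1/2) *\<^sub>R F zs + (1/2) *\<^sub>R (J o\<^sub>L F zs o\<^sub>L J))" (is "op_le ?A ?B")
    unfolding mix regular_map_block[OF F(1) nontriv c comp] U(2) by simp
  then have "op_le (V' o\<^sub>L ?A o\<^sub>L V) (V' o\<^sub>L ?B o\<^sub>L V)"
    by (rule op_le_congruence) (rule C(1))
  moreover have "V' o\<^sub>L ?A o\<^sub>L V = F (map (\<lambda>z. V' o\<^sub>L z o\<^sub>L V) zs)"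
    by (intro blinfun_eqI) (simp add: blinfun.add_left blinfun.add_right C)
  moreover have "V' o\<^sub>L ?B o\<^sub>L V = V' o\<^sub>L F zs o\<^sub>L V"
    by (intro blinfun_eqI)
      (simp add: blinfun.add_left blinfun.add_right blinfun.scaleR_left blinfun.scaleR_right J blinfun.diff_right C
        flip: scaleR_left_distrib)
  ultimately show ?thesis by simp
qed

text \<open>
  The complement of the range of \<open>V = S C + T D\<close> is the kernel of \<open>V' = C' S' + D' T'\<close>. As \<open>C'\<close> is
  invertible, it consists of the vectors \<open>S a + T b\<close> with \<open>a = - M' b\<close>, where \<open>M' = C'\<^sup>-\<^sup>1 D'\<close>: it is
  a graph over the second copy of \<open>H\<close>. The map \<open>b \<mapsto> T b - S M' b\<close> onto it becomes isometric after
  composition with \<open>(1 + M M')\<^sup>-\<^sup>1\<^sup>/\<^sup>2\<close>.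
\<close>

lemma cuntz_pair_completion:
  fixes S :: "'a::chilbert_space operator"
  assumes c: "cuntz_pair S S' T T'"
    and adj: "adjoint_pair C C'" "adjoint_pair D D'" "adjoint_pair L L'"
    and one: "\<And>x. blinfun_apply C' (blinfun_apply C x) + blinfun_apply D' (blinfun_apply D x) = x"
    and inv: "\<And>x. blinfun_apply L (blinfun_apply C x) = x" "\<And>x. blinfun_apply C (blinfun_apply L x) = x"
  obtains W W' where "cuntz_pair ((S o\<^sub>L C) + (T o\<^sub>L D)) ((C' o\<^sub>L S') + (D' o\<^sub>L T')) W W'"
proof -
  note C = cuntz_pairD[OF c]
  have inv': "blinfun_apply C' (blinfun_apply L' x) = x" "blinfun_apply L' (blinfun_apply C' x) = x" for x
  proof -
    show "blinfun_apply C' (blinfun_apply L' x) = x"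
      by (rule cinner_eqI) (simp add: adjoint_pairD[OF adj(1), symmetric] adjoint_pairD[OF adj(3), symmetric] inv)
    show "blinfun_apply L' (blinfun_apply C' x) = x"
      by (rule cinner_eqI) (simp add: adjoint_pairD[OF adj(1), symmetric] adjoint_pairD[OF adj(3), symmetric] inv)
  qed
  define M where "M = D o\<^sub>L L"
  define M' where "M' = L' o\<^sub>L D'"
  have M: "adjoint_pair M M'" unfolding M_def M'_def by (intro adjoint_pair_compose adj)
  define N where "N = id_blinfun + (M o\<^sub>L M')"
  have "0 \<le> inner x (blinfun_apply (M o\<^sub>L M') x)" for x
    using adjoint_pair_inner[OF adjoint_pair_sym[OF M], of x "blinfun_apply M' x", symmetric] by simp
  then have N: "pos_def N"
    unfolding N_def by (intro pos_def_add_nonneg pos_def_id adjoint_pair_compose M adjoint_pair_sym[OF M])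
  define R where "R = op_sqrt N"
  define Q where "Q = op_inv R"
  have R: "pos_def R" "R o\<^sub>L R = N" using op_sqrt_pos_def[OF N] by (auto simp: R_def)
  have RR: "blinfun_apply R (blinfun_apply R x) = x + blinfun_apply M (blinfun_apply M' x)" for x
    using arg_cong[OF R(2), of "\<lambda>U. blinfun_apply U x"] by (simp add: N_def blinfun.add_left)
  have Q: "pos_def Q" "\<And>x. blinfun_apply Q (blinfun_apply R x) = x" "\<And>x. blinfun_apply R (blinfun_apply Q x) = x"
    using op_inv_pos_def[OF R(1)] by (auto simp: Q_def)
  define W where "W = (T - (S o\<^sub>L M')) o\<^sub>L Q"
  define W' where "W' = Q o\<^sub>L (T' - (M o\<^sub>L S'))"
  define V where "V = (S o\<^sub>L C) + (T o\<^sub>L D)"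
  define V' where "V' = (C' o\<^sub>L S') + (D' o\<^sub>L T')"
  have V: "adjoint_pair V V'"
    unfolding V_def V'_def by (intro adjoint_pair_add adjoint_pair_compose adj C)
  have W: "adjoint_pair W W'"
    unfolding W_def W'_def
    by (intro adjoint_pair_compose adjoint_pair_diff C adjoint_pair_sym[OF M] pos_def_selfadjoint Q)
  have V'V: "blinfun_apply V' (blinfun_apply V x) = x" for x
    by (simp add: V_def V'_def blinfun.add_left blinfun.add_right C one)
  have V'W: "blinfun_apply V' (blinfun_apply W x) = 0" for x
    by (simp add: V'_def W_def blinfun.add_left blinfun.diff_left blinfun.diff_right C M'_def inv')
  have W'V: "blinfun_apply W' (blinfun_apply V x) = 0" for x
    by (simp add: W'_def V_def blinfun.add_left blinfun.add_right blinfun.diff_left blinfun.diff_right blinfun.minus_right C M_def inv)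
  have W'W: "blinfun_apply W' (blinfun_apply W x) = x" for x
  proof -
    have "blinfun_apply W' (blinfun_apply W x) = blinfun_apply Q
        (blinfun_apply Q x + blinfun_apply M (blinfun_apply M' (blinfun_apply Q x)))"
      by (simp add: W_def W'_def blinfun.diff_left blinfun.diff_right C blinfun.minus_right blinfun.add_right)
    then show ?thesis unfolding RR[symmetric] by (simp add: Q)
  qed
  have "blinfun_apply V (blinfun_apply V' z) + blinfun_apply W (blinfun_apply W' z) = z" for z
  proof -
    define r where "r = z - blinfun_apply V (blinfun_apply V' z)"
    define a where "a = blinfun_apply S' r"
    define b where "b = blinfun_apply T' r"
    have r: "r = blinfun_apply S a + blinfun_apply T b" by (simp add: a_def b_def C)
    have "blinfun_apply V' r = 0" by (simp add: r_def blinfun.diff_right V'V)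
    then have "blinfun_apply C' a + blinfun_apply D' b = 0"
      by (simp add: V'_def blinfun.add_left a_def b_def)
    then have "blinfun_apply L' (blinfun_apply C' a) + blinfun_apply L' (blinfun_apply D' b) = 0"
      by (simp flip: blinfun.add_right)
    then have a: "a = - blinfun_apply M' b" by (simp add: inv' M'_def add_eq_0_iff2)
    have "blinfun_apply W' r = blinfun_apply Q (b + blinfun_apply M (blinfun_apply M' b))"
      by (simp add: W'_def blinfun.diff_left flip: a_def b_def) (simp add: a blinfun.minus_right)
    then have "blinfun_apply W' r = blinfun_apply R b" unfolding RR[symmetric] by (simp add: Q)
    then have "blinfun_apply W (blinfun_apply W' r) = r"
      by (simp add: W_def Q blinfun.diff_left) (simp add: r a blinfun.minus_right)
    moreover have "blinfun_apply W' r = blinfun_apply W' z"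
      by (simp add: r_def blinfun.diff_right W'V)
    ultimately show ?thesis by (simp add: r_def)
  qed
  then have "cuntz_pair V V' W W'" by (intro cuntz_pairI V W V'V W'W V'W)
  then show thesis using that unfolding V_def V'_def by blast
qed

text \<open>
  Compression of the block diagonal operator \<open>X \<oplus> Y\<close> by the column isometry with entries \<open>C\<close> and \<open>D\<close>.
\<close>

lemma regular_map_jensen:
  fixes F :: "'a::chilbert_space operator list \<Rightarrow> 'a operator"
  assumes inf: "\<nexists>S :: 'a set. finite S \<and> complex_vector.span S = UNIV"
    and F: "regular_map k F" "convex_op_map k F"
    and adj: "adjoint_pair C C'" "adjoint_pair D D'" "adjoint_pair L L'"
    and one: "\<And>x. blinfun_apply C' (blinfun_apply C x) + blinfun_apply D' (blinfun_apply D x) = x"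
    and inv: "\<And>x. blinfun_apply L (blinfun_apply C x) = x" "\<And>x. blinfun_apply C (blinfun_apply L x) = x"
    and xs: "xs \<in> pos_tuples k UNIV" and ys: "ys \<in> pos_tuples k UNIV"
  shows "op_le (F (map2 (\<lambda>x y. (C' o\<^sub>L x o\<^sub>L C) + (D' o\<^sub>L y o\<^sub>L D)) xs ys))
    ((C' o\<^sub>L F xs o\<^sub>L C) + (D' o\<^sub>L F ys o\<^sub>L D))"
proof -
  have nontriv: "(UNIV :: 'a set) \<noteq> {0}"
    using inf complex_vector.span_empty by (metis finite.emptyI)
  obtain S S' T T' :: "'a operator" where c: "cuntz_pair S S' T T'"
    using cuntz_pair_exists[OF inf] by blast
  note ST = cuntz_pairD[OF c]
  let ?V = "(S o\<^sub>L C) + (T o\<^sub>L D)" and ?V' = "(C' o\<^sub>L S') + (D' o\<^sub>L T')"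
  obtain W W' where V: "cuntz_pair ?V ?V' W W'"
    using cuntz_pair_completion[OF c adj one inv] by blast
  let ?zs = "map2 (\<lambda>x y. (S o\<^sub>L x o\<^sub>L S') + (T o\<^sub>L y o\<^sub>L T')) xs ys"
  have eq: "?V' o\<^sub>L ((S o\<^sub>L x o\<^sub>L S') + (T o\<^sub>L y o\<^sub>L T')) o\<^sub>L ?V = (C' o\<^sub>L x o\<^sub>L C) + (D' o\<^sub>L y o\<^sub>L D)" for x y
    by (intro blinfun_eqI) (simp add: blinfun.add_left blinfun.add_right ST)
  have len: "length xs = length ys" using xs ys by (simp add: pos_tuples_def)
  have "op_le (F (map (\<lambda>z. ?V' o\<^sub>L z o\<^sub>L ?V) ?zs)) (?V' o\<^sub>L F ?zs o\<^sub>L ?V)"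
    by (rule regular_map_compression[OF F nontriv V block_pos_tuples[OF c xs ys]])
  moreover have "map (\<lambda>z. ?V' o\<^sub>L z o\<^sub>L ?V) ?zs = map2 (\<lambda>x y. (C' o\<^sub>L x o\<^sub>L C) + (D' o\<^sub>L y o\<^sub>L D)) xs ys"
    unfolding map_map by (intro map_cong refl) (auto simp only: comp_apply eq split: prod.split)
  moreover have "?V' o\<^sub>L F ?zs o\<^sub>L ?V = (C' o\<^sub>L F xs o\<^sub>L C) + (D' o\<^sub>L F ys o\<^sub>L D)"
    unfolding regular_map_block[OF F(1) nontriv c xs ys] by (rule eq)
  ultimately show ?thesis by (simp only:)
qed

section \<open>Perspectives\<close>

lemma perspective_append:
  "perspective F (As @ [B]) =
    op_sqrt B o\<^sub>L F (map (\<lambda>A. op_inv (op_sqrt B) o\<^sub>L A o\<^sub>L op_inv (op_sqrt B)) As) o\<^sub>L op_sqrt B"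
  by (simp add: perspective_def Let_def)

lemma pos_tuples_append_one:
  fixes As :: "'a::chilbert_space operator list"
  assumes "As \<in> pos_tuples (k + 1) UNIV"
  obtains Xs B where "As = Xs @ [B]" "Xs \<in> pos_tuples k UNIV" "pos_def B"
proof -
  have "As \<noteq> []" using assms by (auto simp: pos_tuples_def)
  then have "As = butlast As @ [last As]" by simp
  moreover have "butlast As \<in> pos_tuples k UNIV" "pos_def (last As)"
    using assms \<open>As \<noteq> []\<close> by (auto simp: pos_tuples_UNIV dest: in_set_butlastD)
  ultimately show thesis using that by blast
qed

lemma pos_tuples_normalize:
  fixes Xs :: "'a::chilbert_space operator list"
  assumes B: "pos_def B" and Xs: "Xs \<in> pos_tuples k UNIV"
  shows "map (\<lambda>A. op_inv (op_sqrt B) o\<^sub>L A o\<^sub>L op_inv (op_sqrt B)) Xs \<in> pos_tuples k UNIV"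
proof -
  note R = op_sqrt_pos_def(1)[OF B]
  note Q = op_inv_pos_def[OF R]
  show ?thesis
    using Xs pos_def_congruence[OF _ pos_def_selfadjoint[OF Q(1)] Q(3)] by (auto simp: pos_tuples_UNIV)
qed

text \<open>
  Jensen's inequality with \<open>C = (l B)\<^sup>1\<^sup>/\<^sup>2 T\<^sup>-\<^sup>1\<^sup>/\<^sup>2\<close> and \<open>D = ((1 - l) B')\<^sup>1\<^sup>/\<^sup>2 T\<^sup>-\<^sup>1\<^sup>/\<^sup>2\<close>, conjugated by
  \<open>T\<^sup>1\<^sup>/\<^sup>2\<close>, where \<open>T = l B + (1 - l) B'\<close>; invertibility of \<open>C\<close> is what requires \<open>l \<noteq> 0\<close>.
\<close>

lemma perspective_convex_interior:
  fixes F :: "'a::chilbert_space operator list \<Rightarrow> 'a operator"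
  assumes inf: "\<nexists>S :: 'a set. finite S \<and> complex_vector.span S = UNIV"
    and F: "regular_map k F" "convex_op_map k F" and l: "0 < l" "l < 1"
    and A: "As \<in> pos_tuples k UNIV" "As' \<in> pos_tuples k UNIV" and B: "pos_def B" "pos_def B'"
  shows "op_le (perspective F (map2 (\<lambda>A A'. l *\<^sub>R A + (1 - l) *\<^sub>R A') As As' @ [l *\<^sub>R B + (1 - l) *\<^sub>R B']))
    (l *\<^sub>R perspective F (As @ [B]) + (1 - l) *\<^sub>R perspective F (As' @ [B']))"
proof -
  define T where "T = l *\<^sub>R B + (1 - l) *\<^sub>R B'"
  have T: "pos_def T" unfolding T_def using l B by (intro pos_def_add pos_def_scaleR) auto
  define b where "b = op_sqrt B"
  define b' where "b' = op_sqrt B'"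
  define t where "t = op_sqrt T"
  define q where "q = op_inv b"
  define q' where "q' = op_inv b'"
  define s where "s = op_inv t"
  have pos: "pos_def b" "pos_def b'" "pos_def t"
    unfolding b_def b'_def t_def using B T by (auto intro: op_sqrt_pos_def)
  have posi: "pos_def q" "pos_def q'" "pos_def s"
    unfolding q_def q'_def s_def using pos by (auto intro: op_inv_pos_def)
  note adj = pos[THEN pos_def_selfadjoint] posi[THEN pos_def_selfadjoint]
  have inv: "blinfun_apply q (blinfun_apply b x) = x" "blinfun_apply b (blinfun_apply q x) = x"
    "blinfun_apply q' (blinfun_apply b' x) = x" "blinfun_apply b' (blinfun_apply q' x) = x"
    "blinfun_apply s (blinfun_apply t x) = x" "blinfun_apply t (blinfun_apply s x) = x" for x
    using op_inv_pos_def[OF pos(1)] op_inv_pos_def[OF pos(2)] op_inv_pos_def[OF pos(3)]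
    by (auto simp: q_def q'_def s_def)
  have sq: "b o\<^sub>L b = B" "b' o\<^sub>L b' = B'" "t o\<^sub>L t = T"
    unfolding b_def b'_def t_def using B T by (auto intro: op_sqrt_pos_def)
  have T_apply: "l *\<^sub>R blinfun_apply b (blinfun_apply b x) + (1 - l) *\<^sub>R blinfun_apply b' (blinfun_apply b' x)
      = blinfun_apply t (blinfun_apply t x)" for x
  proof -
    have "blinfun_apply (l *\<^sub>R (b o\<^sub>L b) + (1 - l) *\<^sub>R (b' o\<^sub>L b')) x = blinfun_apply (t o\<^sub>L t) x"
      unfolding sq T_def ..
    then show ?thesis by (simp add: blinfun.add_left blinfun.scaleR_left)
  qed
  define m where "m = sqrt l"
  define m' where "m' = sqrt (1 - l)"
  have m: "m * m = l" "m' * m' = 1 - l" "m \<noteq> 0" using l by (auto simp: m_def m'_def)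
  define C where "C = m *\<^sub>R (b o\<^sub>L s)"
  define C' where "C' = m *\<^sub>R (s o\<^sub>L b)"
  define D where "D = m' *\<^sub>R (b' o\<^sub>L s)"
  define D' where "D' = m' *\<^sub>R (s o\<^sub>L b')"
  define L where "L = (1 / m) *\<^sub>R (t o\<^sub>L q)"
  define L' where "L' = (1 / m) *\<^sub>R (q o\<^sub>L t)"
  note defs = C_def C'_def D_def D'_def L_def L'_def
  have CDL: "adjoint_pair C C'" "adjoint_pair D D'" "adjoint_pair L L'"
    unfolding defs by (intro adjoint_pair_scaleR adjoint_pair_compose adj)+
  have one: "blinfun_apply C' (blinfun_apply C x) + blinfun_apply D' (blinfun_apply D x) = x" for x
  proof -
    have "blinfun_apply C' (blinfun_apply C x) + blinfun_apply D' (blinfun_apply D x)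
        = blinfun_apply s (l *\<^sub>R blinfun_apply b (blinfun_apply b (blinfun_apply s x))
            + (1 - l) *\<^sub>R blinfun_apply b' (blinfun_apply b' (blinfun_apply s x)))"
      by (simp add: defs blinfun.scaleR_left blinfun.scaleR_right blinfun.add_right m)
    then show ?thesis unfolding T_apply by (simp add: inv)
  qed
  have LC: "blinfun_apply L (blinfun_apply C x) = x" "blinfun_apply C (blinfun_apply L x) = x" for x
    using m(3) by (simp_all add: defs blinfun.scaleR_left blinfun.scaleR_right inv)
  define Xs where "Xs = map (\<lambda>A. q o\<^sub>L A o\<^sub>L q) As"
  define Ys where "Ys = map (\<lambda>A. q' o\<^sub>L A o\<^sub>L q') As'"
  have XY: "Xs \<in> pos_tuples k UNIV" "Ys \<in> pos_tuples k UNIV"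
    unfolding Xs_def Ys_def q_def q'_def b_def b'_def using A B by (auto intro: pos_tuples_normalize)
  have len: "length As = length As'" using A by (simp add: pos_tuples_def)
  have elem: "(C' o\<^sub>L (q o\<^sub>L x o\<^sub>L q) o\<^sub>L C) + (D' o\<^sub>L (q' o\<^sub>L y o\<^sub>L q') o\<^sub>L D)
      = s o\<^sub>L (l *\<^sub>R x + (1 - l) *\<^sub>R y) o\<^sub>L s" for x y
    by (intro blinfun_eqI)
      (simp add: defs blinfun.scaleR_left blinfun.scaleR_right blinfun.add_left blinfun.add_right m inv)
  have mix: "map2 (\<lambda>x y. (C' o\<^sub>L x o\<^sub>L C) + (D' o\<^sub>L y o\<^sub>L D)) Xs Ys
      = map (\<lambda>z. s o\<^sub>L z o\<^sub>L s) (map2 (\<lambda>A A'. l *\<^sub>R A + (1 - l) *\<^sub>R A') As As')"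
    unfolding Xs_def Ys_def using len
    by (intro nth_equalityI) (simp_all only: length_map length_zip nth_map nth_zip min.idem prod.case elem)
  let ?X = "F (map (\<lambda>z. s o\<^sub>L z o\<^sub>L s) (map2 (\<lambda>A A'. l *\<^sub>R A + (1 - l) *\<^sub>R A') As As'))"
    and ?Y = "(C' o\<^sub>L F Xs o\<^sub>L C) + (D' o\<^sub>L F Ys o\<^sub>L D)"
  have "op_le ?X ?Y"
    using regular_map_jensen[OF inf F CDL one LC XY] unfolding mix .
  then have "op_le (t o\<^sub>L ?X o\<^sub>L t) (t o\<^sub>L ?Y o\<^sub>L t)"
    by (rule op_le_congruence) (rule adj)
  moreover have "t o\<^sub>L ?X o\<^sub>L t
      = perspective F (map2 (\<lambda>A A'. l *\<^sub>R A + (1 - l) *\<^sub>R A') As As' @ [l *\<^sub>R B + (1 - l) *\<^sub>R B'])"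
    unfolding perspective_append T_def[symmetric] t_def s_def ..
  moreover have "t o\<^sub>L ?Y o\<^sub>L t = l *\<^sub>R (b o\<^sub>L F Xs o\<^sub>L b) + (1 - l) *\<^sub>R (b' o\<^sub>L F Ys o\<^sub>L b')"
    by (intro blinfun_eqI)
      (simp add: defs blinfun.scaleR_left blinfun.scaleR_right blinfun.add_left blinfun.add_right m inv)
  moreover have "b o\<^sub>L F Xs o\<^sub>L b = perspective F (As @ [B])"
    unfolding perspective_append Xs_def q_def b_def ..
  moreover have "b' o\<^sub>L F Ys o\<^sub>L b' = perspective F (As' @ [B'])"
    unfolding perspective_append Ys_def q'_def b'_def ..
  ultimately show ?thesis by (simp only:)
qed

lemma op_le_refl: "op_le T T"
  by (simp add: op_le_def positive_op_def)

theorem theorem3p2: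
  fixes F :: "'a::chilbert_space operator list \<Rightarrow> 'a operator" and k :: nat
  assumes "\<nexists>S :: 'a set. finite S \<and> complex_vector.span S = UNIV"
    and "k \<ge> 1"
    and "F \<in> pos_tuples k UNIV \<rightarrow> bounded_ops UNIV"
    and "convex_op_map k F"
    and "regular_map k F"
  shows "perspective F \<in> pos_tuples (k + 1) UNIV \<rightarrow> bounded_ops UNIV \<and>
    convex_op_map (k + 1) (perspective F)"
proof
  show "perspective F \<in> pos_tuples (k + 1) UNIV \<rightarrow> bounded_ops UNIV"
  proof
    fix As :: "'a operator list" assume "As \<in> pos_tuples (k + 1) UNIV"
    then obtain Xs B where As: "As = Xs @ [B]" "Xs \<in> pos_tuples k UNIV" "pos_def B"
      by (rule pos_tuples_append_one)
    have "clinear_op (F (map (\<lambda>A. op_inv (op_sqrt B) o\<^sub>L A o\<^sub>L op_inv (op_sqrt B)) Xs))"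
      using assms(3) pos_tuples_normalize[OF As(3,2)] by (auto simp: bounded_ops_UNIV)
    moreover have "clinear_op (op_sqrt B)"
      using op_sqrt_pos_def(1)[OF As(3)] by (intro adjoint_pair_clinear[OF pos_def_selfadjoint])
    ultimately show "perspective F As \<in> bounded_ops UNIV"
      unfolding As(1) perspective_append bounded_ops_UNIV by (intro clinear_op_compose)
  qed
  show "convex_op_map (k + 1) (perspective F)"
    unfolding convex_op_map_def
  proof (intro ballI)
    fix As As' :: "'a operator list" and l :: real
    assume As: "As \<in> pos_tuples (k + 1) UNIV" and As': "As' \<in> pos_tuples (k + 1) UNIV" and l: "l \<in> {0..1}"
    let ?mix = "map2 (\<lambda>A B. l *\<^sub>R A + (1 - l) *\<^sub>R B) As As'"
    have len: "length As = length As'" using As As' by (simp add: pos_tuples_def)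
    consider "l = 0" | "l = 1" | "0 < l" "l < 1" using l by force
    then show "op_le (perspective F ?mix) (l *\<^sub>R perspective F As + (1 - l) *\<^sub>R perspective F As')"
    proof cases
      case 1
      then have "?mix = As'" using len by (intro nth_equalityI) auto
      then show ?thesis using 1 by (simp add: op_le_refl)
    next
      case 2
      then have "?mix = As" using len by (intro nth_equalityI) auto
      then show ?thesis using 2 by (simp add: op_le_refl)
    next
      case 3
      obtain Xs B where A: "As = Xs @ [B]" "Xs \<in> pos_tuples k UNIV" "pos_def B"
        using As by (rule pos_tuples_append_one)
      obtain Ys B' where A': "As' = Ys @ [B']" "Ys \<in> pos_tuples k UNIV" "pos_def B'"
        using As' by (rule pos_tuples_append_one)
      have "length Xs = length Ys" using A(2) A'(2) by (simp add: pos_tuples_def)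
      then have "?mix = map2 (\<lambda>A B. l *\<^sub>R A + (1 - l) *\<^sub>R B) Xs Ys @ [l *\<^sub>R B + (1 - l) *\<^sub>R B']"
        unfolding A(1) A'(1) by simp
      then show ?thesis
        using perspective_convex_interior[OF assms(1,5,4) 3 A(2) A'(2) A(3) A'(3)] unfolding A(1) A'(1) by (simp only:)
    qed
  qed
qed

end
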